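(* Let $G$ be a finite graph and let $k$ and $\ell$ be the Wollan's tree-cut width and the ab-tree-cut width of $G$, respectively. Then $\frac{k}{2}-1\leq \ell\leq k^2$.
   Context: Graphs are finite and undirected; parallel edges are allowed, loops are not. A near-partition of a set $\Omega$ is a family of pairwise disjoint (possibly empty) subsets of $\Omega$ with union $\Omega$. A tree-cut decomposition of $G$ is a pair $\mathcal{T}=(T,\mathcal{X})$ where $T$ is a tree and $\mathcal{X}=\{X_t : t\in V(T)\}$ is a near-partition of $V(G)$ indexed by the nodes of $T$; $X_t$ is the bag of $t$. For an edge $st$ of $T$, $\mathrm{adh}(st)$ is the set of edges $uv$ of $G$ such that the node whose bag contains $u$ and the node whose bag contains $v$ lie in different components of $T-st$. The edge $st$ is bold if $|\mathrm{adh}(st)|\geq 3$ and thin otherwise. ab-tree-cut width. For a node $t$, $\mathrm{adh}(t)$ is the union of the sets $\mathrm{adh}(st)$ over all bold edges $st$ of $T$ incident to $t$. The adhesion-width of $\mathcal{T}$ is $\max_{t\in V(T)}|\mathrm{adh}(t)|$ and the bag-width of $\mathcal{T}$ is $\max_{t\in V(T)}|X_t|$. The ab-tree-cut width of $G$ is the least number $\ell$ such that $G$ has a tree-cut decomposition with adhesion-width $\leq \ell$ and bag-width $\leq \ell$. Wollan's tree-cut width. The trace of a pair of vertices $u,v$ of $G$ in $\mathcal{T}$ is the path in $T$ between the node whose bag contains $u$ and the node whose bag contains $v$ (a single node if these coincide). For a node $t$ of $T$, define the equivalence relation $\sim_t$ on $V(G)$ by: $u\sim_t v$ if $u=v$,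 or $u\neq v$ and the trace of $\{u,v\}$ does not contain $t$. The torso $G_t$ is the quotient graph of $G$ by $\sim_t$: its vertices are the equivalence classes of $\sim_t$, and each edge $uv$ of $G$ with $u\not\sim_t v$ gives rise to one edge of $G_t$ between the classes of $u$ and $v$ (so parallel edges are kept, and edges inside a class are discarded); vertices of $X_t$ form singleton classes and are regarded as vertices of $G_t$. The 3-center $\widetilde{G}_t$ is obtained from $G_t$ by iteratively suppressing vertices of degree at most 2 that do not belong to $X_t$, where suppressing a vertex of degree at most 2 means deleting it if it has at most one neighbor, and deleting it and adding an edge between its two former neighbors if it has exactly two neighbors (the order of suppressions does not matter; degrees count parallel edges). The Wollan's width of $\mathcal{T}$ is $\max\left(\{|\mathrm{adh}(e)| : e\in E(T)\}\cup\{|V(\widetilde{G}_t)| : t\in V(T)\}\right)$, and the Wollan's tree-cut width of $G$ is the minimum Wollan's width of a tree-cut decomposition of $G$. *)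

theory Defs
  imports Complex_Main "HOL-Library.Disjoint_Sets"
begin

record ('v, 'e) mgraph =
  verts :: "'v set"
  edges :: "'e set"
  ends :: "'e \<Rightarrow> 'v set"

definition multigraph :: "('v, 'e) mgraph \<Rightarrow> bool" where
  "multigraph G \<longleftrightarrow> finite (verts G) \<and> finite (edges G) \<and>
     (\<forall>e\<in>edges G. ends G e \<subseteq> verts G \<and> card (ends G e) = 2)"

definition adjacent :: "('v, 'e) mgraph \<Rightarrow> 'v \<Rightarrow> 'v \<Rightarrow> bool" where
  "adjacent G u v \<longleftrightarrow> (\<exists>e\<in>edges G. ends G e = {u, v})"

definition incident_edges :: "('v, 'e) mgraph \<Rightarrow> 'v \<Rightarrow> 'e set" where
  "incident_edges G v = {e \<in> edges G. v \<in> ends G e}"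

definition neighbors :: "('v, 'e) mgraph \<Rightarrow> 'v \<Rightarrow> 'v set" where
  "neighbors G v = {w. adjacent G v w}"

definition degree :: "('v, 'e) mgraph \<Rightarrow> 'v \<Rightarrow> nat" where
  "degree G v = card (incident_edges G v)"

definition delete_vertex :: "('v, 'e) mgraph \<Rightarrow> 'v \<Rightarrow> ('v, 'e) mgraph" where
  "delete_vertex G v =
     \<lparr>verts = verts G - {v}, edges = edges G - incident_edges G v, ends = ends G\<rparr>"

definition delete_edge :: "('v, 'e) mgraph \<Rightarrow> 'e \<Rightarrow> ('v, 'e) mgraph" where
  "delete_edge G e = \<lparr>verts = verts G, edges = edges G - {e}, ends = ends G\<rparr>"

definition add_edge :: "('v, 'e) mgraph \<Rightarrow> 'e \<Rightarrow> 'v set \<Rightarrow> ('v, 'e) mgraph" where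
  "add_edge G e A = \<lparr>verts = verts G, edges = insert e (edges G), ends = (ends G)(e := A)\<rparr>"

text \<open>Quotient by an equivalence relation on the vertices: parallel edges are kept,
  edges inside a class are discarded.\<close>

definition quotient_graph :: "('v, 'e) mgraph \<Rightarrow> ('v \<times> 'v) set \<Rightarrow> ('v set, 'e) mgraph" where
  "quotient_graph G R =
     \<lparr>verts = verts G // R,
      edges = {e \<in> edges G. \<exists>u v. ends G e = {u, v} \<and> (u, v) \<notin> R},
      ends = (\<lambda>e. (\<lambda>u. R `` {u}) ` ends G e)\<rparr>"

definition connected_in :: "('v, 'e) mgraph \<Rightarrow> 'v \<Rightarrow> 'v \<Rightarrow> bool" where
  "connected_in G = (adjacent G)\<^sup>*\<^sup>*"

definition is_path :: "('v, 'e) mgraph \<Rightarrow> 'v \<Rightarrow> 'v list \<Rightarrow> 'v \<Rightarrow> bool" where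
  "is_path G u p v \<longleftrightarrow> p \<noteq> [] \<and> hd p = u \<and> last p = v \<and> set p \<subseteq> verts G \<and> distinct p \<and>
     successively (adjacent G) p"

text \<open>Two parallel edges form a cycle of length two.\<close>

definition is_cycle :: "('v, 'e) mgraph \<Rightarrow> 'v list \<Rightarrow> 'e list \<Rightarrow> bool" where
  "is_cycle G xs es \<longleftrightarrow> length xs \<ge> 2 \<and> length es = length xs \<and> distinct xs \<and> distinct es \<and>
     set xs \<subseteq> verts G \<and> set es \<subseteq> edges G \<and>
     (\<forall>i<length xs. ends G (es ! i) = {xs ! i, xs ! ((i + 1) mod length xs)})"

definition is_tree :: "('v, 'e) mgraph \<Rightarrow> bool" where
  "is_tree T \<longleftrightarrow> multigraph T \<and> verts T \<noteq> {} \<and>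
     (\<forall>s\<in>verts T. \<forall>t\<in>verts T. connected_in T s t) \<and> (\<nexists>xs es. is_cycle T xs es)"

text \<open>In the following, \<open>X t\<close> is the bag of the node \<open>t\<close>; the values of \<open>X\<close> outside
  \<open>verts T\<close> are irrelevant.\<close>

definition tree_cut_decomposition ::
  "('v, 'e) mgraph \<Rightarrow> ('n, 'f) mgraph \<Rightarrow> ('n \<Rightarrow> 'v set) \<Rightarrow> bool" where
  "tree_cut_decomposition G T X \<longleftrightarrow>
     is_tree T \<and> disjoint_family_on X (verts T) \<and> (\<Union>t\<in>verts T. X t) = verts G"

definition node_of :: "('n, 'f) mgraph \<Rightarrow> ('n \<Rightarrow> 'v set) \<Rightarrow> 'v \<Rightarrow> 'n" where
  "node_of T X v = (THE t. t \<in> verts T \<and> v \<in> X t)"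

definition adh_edge ::
  "('v, 'e) mgraph \<Rightarrow> ('n, 'f) mgraph \<Rightarrow> ('n \<Rightarrow> 'v set) \<Rightarrow> 'f \<Rightarrow> 'e set" where
  "adh_edge G T X f = {e \<in> edges G. \<exists>u v. ends G e = {u, v} \<and>
     \<not> connected_in (delete_edge T f) (node_of T X u) (node_of T X v)}"

definition bold ::
  "('v, 'e) mgraph \<Rightarrow> ('n, 'f) mgraph \<Rightarrow> ('n \<Rightarrow> 'v set) \<Rightarrow> 'f \<Rightarrow> bool" where
  "bold G T X f \<longleftrightarrow> card (adh_edge G T X f) \<ge> 3"

definition adh_node ::
  "('v, 'e) mgraph \<Rightarrow> ('n, 'f) mgraph \<Rightarrow> ('n \<Rightarrow> 'v set) \<Rightarrow> 'n \<Rightarrow> 'e set" where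
  "adh_node G T X t = (\<Union>f\<in>{f \<in> incident_edges T t. bold G T X f}. adh_edge G T X f)"

definition adhesion_width ::
  "('v, 'e) mgraph \<Rightarrow> ('n, 'f) mgraph \<Rightarrow> ('n \<Rightarrow> 'v set) \<Rightarrow> nat" where
  "adhesion_width G T X = Max ((\<lambda>t. card (adh_node G T X t)) ` verts T)"

definition bag_width :: "('n, 'f) mgraph \<Rightarrow> ('n \<Rightarrow> 'v set) \<Rightarrow> nat" where
  "bag_width T X = Max ((\<lambda>t. card (X t)) ` verts T)"

text \<open>Every finite tree is isomorphic to one whose nodes and edges are natural numbers, so
  letting decompositions range over such trees is no restriction.\<close>

definition ab_tree_cut_width :: "('v, 'e) mgraph \<Rightarrow> nat" where
  "ab_tree_cut_width G = (LEAST l. \<exists>(T :: (nat, nat) mgraph) X.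
     tree_cut_decomposition G T X \<and> adhesion_width G T X \<le> l \<and> bag_width T X \<le> l)"

definition trace :: "('n, 'f) mgraph \<Rightarrow> ('n \<Rightarrow> 'v set) \<Rightarrow> 'v \<Rightarrow> 'v \<Rightarrow> 'n list" where
  "trace T X u v = (THE p. is_path T (node_of T X u) p (node_of T X v))"

definition torso_rel ::
  "('v, 'e) mgraph \<Rightarrow> ('n, 'f) mgraph \<Rightarrow> ('n \<Rightarrow> 'v set) \<Rightarrow> 'n \<Rightarrow> ('v \<times> 'v) set" where
  "torso_rel G T X t = {(u, v). u \<in> verts G \<and> v \<in> verts G \<and>
     (u = v \<or> u \<noteq> v \<and> t \<notin> set (trace T X u v))}"

definition torso ::
  "('v, 'e) mgraph \<Rightarrow> ('n, 'f) mgraph \<Rightarrow> ('n \<Rightarrow> 'v set) \<Rightarrow> 'n \<Rightarrow> ('v set, 'e) mgraph" where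
  "torso G T X t = quotient_graph G (torso_rel G T X t)"

text \<open>One suppression of a vertex outside \<open>P\<close>. The name of the added edge is that of one of the
  edges deleted together with \<open>v\<close>, so that it is fresh without assuming an infinite type of edges.\<close>

inductive suppression :: "'v set \<Rightarrow> ('v, 'e) mgraph \<Rightarrow> ('v, 'e) mgraph \<Rightarrow> bool" for P where
  delete: "v \<in> verts H \<Longrightarrow> v \<notin> P \<Longrightarrow> degree H v \<le> 2 \<Longrightarrow> card (neighbors H v) \<le> 1 \<Longrightarrow>
    suppression P H (delete_vertex H v)"
| bypass: "v \<in> verts H \<Longrightarrow> v \<notin> P \<Longrightarrow> degree H v \<le> 2 \<Longrightarrow> neighbors H v = {a, b} \<Longrightarrow> a \<noteq> b \<Longrightarrow>
    e \<in> incident_edges H v \<Longrightarrow> suppression P H (add_edge (delete_vertex H v) e {a, b})"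

text \<open>The result of exhaustive suppression does not depend, up to isomorphism, on the order of
  the suppressions or on the names of the added edges, so an arbitrary one is chosen.\<close>

definition three_center ::
  "('v, 'e) mgraph \<Rightarrow> ('n, 'f) mgraph \<Rightarrow> ('n \<Rightarrow> 'v set) \<Rightarrow> 'n \<Rightarrow> ('v set, 'e) mgraph" where
  "three_center G T X t = (let P = (\<lambda>x. {x}) ` X t in
     SOME H. (suppression P)\<^sup>*\<^sup>* (torso G T X t) H \<and> (\<nexists>H'. suppression P H H'))"

definition wollan_width ::
  "('v, 'e) mgraph \<Rightarrow> ('n, 'f) mgraph \<Rightarrow> ('n \<Rightarrow> 'v set) \<Rightarrow> nat" where
  "wollan_width G T X = Max ((\<lambda>f. card (adh_edge G T X f)) ` edges T \<union>
     (\<lambda>t. card (verts (three_center G T X t))) ` verts T)"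

definition wollan_tree_cut_width :: "('v, 'e) mgraph \<Rightarrow> nat" where
  "wollan_tree_cut_width G = (LEAST k. \<exists>(T :: (nat, nat) mgraph) X.
     tree_cut_decomposition G T X \<and> wollan_width G T X = k)"

end

theory Submission
  imports Defs
begin

(*
  k \<le> 2 l + 2: suppressions never increase degrees, so a vertex of the 3-center outside X_t has degree
  at least 3 in the torso and thus comes from a bold edge at t; every edge of adh(t) lies in at most
  two of the sets adh(f), hence there are at most 2 l / 3 bold edges at t.

  l \<le> k^2: a bold edge at t may correspond to a torso vertex that is suppressed after all, so an
  optimal decomposition for Wollan's width has to be modified first. Suppressing v amounts to
  contracting v into a neighbour, and everything contracted into v so far, together with v, is a
  vertex set of G with at most two edges leaving it. Replaying the suppressions at t, the tree edges
  at t that belong to this set are moved to a new node, which is joined to t by a thin edge; at most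
  one of the moved edges is bold, since the parts contracted into v earlier already hang on thin
  edges. In the end each bold edge at t belongs to its own vertex of the 3-center, so there are at
  most k of them. The other nodes see the same cuts as before, so all nodes can be treated in turn.
*)

section \<open>Trees\<close>

text \<open>Torso, trace and adhesion are defined through paths in the tree. All of them are
  rewritten in terms of the \<open>side\<close> of an edge at a node, the part of the graph that
  hangs on that edge. Whatever leaves the sides at a node unchanged leaves its torso unchanged,
  which is why treating one node does no harm to the others.

  A replay has to survive changes of the tree at \<open>t\<close>, so a stage of it is described by
  a map \<open>\<phi>\<close> on the vertices of \<open>G\<close> and not on those of the torso. It
  works along an arbitrary sequence of suppressions, hence along the one behind the choice in
  \<open>three_center\<close>.

  The first inequality reads k \<le> 2 l + 2. A 3-center has at most 2 l vertices, l for the bag and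
  at most l for the bold edges; the additional 2 allows for thin edges, whose adhesion counts for
  Wollan's width but not for l. The square in the second inequality is at most k bold edges at a
  node times at most k graph edges in the adhesion of each.\<close>

lemma adjacentI: "e \<in> edges G \<Longrightarrow> ends G e = {u, v} \<Longrightarrow> adjacent G u v"
  by (auto simp: adjacent_def)

lemma adjacent_sym: "adjacent G u v \<Longrightarrow> adjacent G v u"
  by (auto simp: adjacent_def insert_commute)

lemma connected_in_refl [simp]: "connected_in G u u"
  by (simp add: connected_in_def)

lemma connected_in_sym: "connected_in G u v \<Longrightarrow> connected_in G v u"
  unfolding connected_in_def
  by (rule sympD[OF symp_rtranclp]) (auto intro: sympI adjacent_sym)

lemma connected_in_trans: "connected_in G u v \<Longrightarrow> connected_in G v w \<Longrightarrow> connected_in G u w"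
  by (simp add: connected_in_def)

lemma connected_in_adjacent: "adjacent G u v \<Longrightarrow> connected_in G u v"
  by (simp add: connected_in_def)

lemma adjacent_delete_edgeI:
  "e \<in> edges G \<Longrightarrow> e \<noteq> f \<Longrightarrow> ends G e = {u, v} \<Longrightarrow> adjacent (delete_edge G f) u v"
  by (auto simp: adjacent_def delete_edge_def)

lemma adjacent_delete_edgeE:
  assumes "adjacent (delete_edge G f) u v"
  obtains e where "e \<in> edges G" "e \<noteq> f" "ends G e = {u, v}"
  using assms by (auto simp: adjacent_def delete_edge_def)

lemma successively_rtranclp:
  "successively R p \<Longrightarrow> p \<noteq> [] \<Longrightarrow> R\<^sup>*\<^sup>* (hd p) (last p)"
proof (induction p)
  case (Cons x p)
  then show ?case
    by (cases p) (auto intro: converse_rtranclp_into_rtranclp)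
qed simp

lemma successively_connected_in:
  "successively (adjacent G) p \<Longrightarrow> p \<noteq> [] \<Longrightarrow> connected_in G (hd p) (last p)"
  by (simp add: connected_in_def successively_rtranclp)

lemma rtranclp_obtain_distinct:
  assumes "R\<^sup>*\<^sup>* a b"
  obtains p where "p \<noteq> []" "hd p = a" "last p = b" "distinct p" "successively R p"
proof -
  from assms have "\<exists>p. p \<noteq> [] \<and> hd p = a \<and> last p = b \<and> distinct p \<and> successively R p"
  proof (induction rule: rtranclp_induct)
    case base
    show ?case by (intro exI[of _ "[a]"]) simp
  next
    case (step b c)
    then obtain p where p: "p \<noteq> []" "hd p = a" "last p = b" "distinct p" "successively R p"
      by blast
    show ?case
    proof (cases "c \<in> set p")
      case True
      then obtain q r where "p = q @ c # r" by (auto simp: in_set_conv_decomp)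
      then show ?thesis using p
        by (intro exI[of _ "q @ [c]"]) (auto simp: successively_append_iff hd_append)
    next
      case False
      then show ?thesis using p step.hyps
        by (intro exI[of _ "p @ [c]"]) (auto simp: successively_append_iff)
    qed
  qed
  then show ?thesis using that by blast
qed

lemma successively_avoiding_edge:
  assumes "successively (adjacent G) p" "ends G f = {a, b}"
    and "\<And>i. Suc i < length p \<Longrightarrow> {p ! i, p ! Suc i} \<noteq> {a, b}"
  shows "successively (adjacent (delete_edge G f)) p"
  unfolding successively_conv_nth
proof (intro allI impI)
  fix i assume i: "Suc i < length p"
  with assms(1) obtain e where "e \<in> edges G" "ends G e = {p ! i, p ! Suc i}"
    by (auto simp: successively_conv_nth adjacent_def)
  with assms(2,3) i show "adjacent (delete_edge G f) (p ! i) (p ! Suc i)"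
    by (intro adjacent_delete_edgeI[of e]) auto
qed

lemma successively_avoiding_vertex:
  assumes "successively (adjacent G) p" "ends G f = {a, b}" "a \<notin> set p"
  shows "successively (adjacent (delete_edge G f)) p"
  using assms(1,2)
proof (rule successively_avoiding_edge)
  fix i assume "Suc i < length p"
  then show "{p ! i, p ! Suc i} \<noteq> {a, b}"
    using assms(3) by (metis Suc_lessD insertI1 insertE nth_mem singletonD)
qed

lemma multigraph_endsE:
  assumes "multigraph G" "e \<in> edges G"
  obtains u v where "ends G e = {u, v}" "u \<noteq> v" "u \<in> verts G" "v \<in> verts G"
  using assms by (auto simp: multigraph_def card_2_iff)

lemma multigraph_incidentE:
  assumes "multigraph G" "e \<in> incident_edges G u"
  obtains v where "e \<in> edges G" "ends G e = {u, v}" "u \<noteq> v" "u \<in> verts G" "v \<in> verts G"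
proof -
  have "e \<in> edges G" "u \<in> ends G e" using assms(2) by (auto simp: incident_edges_def)
  moreover from multigraph_endsE[OF assms(1) this(1)] obtain a b
    where "ends G e = {a, b}" "a \<noteq> b" "a \<in> verts G" "b \<in> verts G" .
  ultimately show ?thesis using that by auto
qed

lemma multigraph_adjacent_verts:
  "multigraph G \<Longrightarrow> adjacent G u v \<Longrightarrow> u \<in> verts G \<and> v \<in> verts G"
  unfolding adjacent_def by (metis insert_subset multigraph_def)

section \<open>Acyclicity in terms of bridges\<close>

lemma is_tree_bridge:
  assumes T: "is_tree T" and e: "e \<in> edges T" "ends T e = {a, b}"
  shows "\<not> connected_in (delete_edge T e) a b"
proof
  assume "connected_in (delete_edge T e) a b"
  then obtain p where p: "p \<noteq> []" "hd p = a" "last p = b" "distinct p"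
      "successively (adjacent (delete_edge T e)) p"
    unfolding connected_in_def by (rule rtranclp_obtain_distinct)
  have mT: "multigraph T" using T by (simp add: is_tree_def)
  have "a \<noteq> b" using mT e by (auto simp: multigraph_def)
  then have len: "length p \<ge> 2" using p(1-3)
    by (cases p; cases "tl p") auto
  have "\<exists>g. \<forall>i. Suc i < length p \<longrightarrow> g i \<in> edges T \<and> g i \<noteq> e \<and> ends T (g i) = {p ! i, p ! Suc i}"
    using p(5) by (intro choice) (auto simp: successively_conv_nth elim!: adjacent_delete_edgeE)
  then obtain g where g: "\<And>i. Suc i < length p \<Longrightarrow> g i \<in> edges T \<and> g i \<noteq> e \<and> ends T (g i) = {p ! i, p ! Suc i}"
    by blast
  \<comment> \<open>\<open>e\<close> closes the path to a cycle. If the path has just one edge, this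
    is a cycle of length two, and \<open>g i \<noteq> e\<close> is what keeps its edges
    distinct.\<close>
  define h where "h i = (if Suc i < length p then g i else e)" for i
  define es where "es = map h [0..<length p]"
  have inj: "i = j" if "Suc i < length p" "Suc j < length p" "g i = g j" for i j
  proof -
    have "{p ! i, p ! Suc i} = {p ! j, p ! Suc j}" using g that by metis
    then show ?thesis using p(4) that by (auto simp: doubleton_eq_iff nth_eq_iff_index_eq)
  qed
  have "inj_on h {0..<length p}"
  proof (rule inj_onI)
    fix i j assume "i \<in> {0..<length p}" "j \<in> {0..<length p}" "h i = h j"
    then show "i = j" using inj[of i j] g[of i] g[of j]
      by (auto simp: h_def split: if_splits)
  qed
  then have "distinct es" by (simp add: es_def distinct_map)
  moreover have "set p \<subseteq> verts T"
  proof
    fix x assume "x \<in> set p"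
    then obtain i where i: "i < length p" "x = p ! i" by (auto simp: in_set_conv_nth)
    show "x \<in> verts T"
    proof (cases "Suc i < length p")
      case True then show ?thesis using g[of i] i mT by (auto simp: multigraph_def)
    next
      case False
      then have "i = length p - 1" using i by auto
      then have "x = b" using i p by (simp add: last_conv_nth)
      then show ?thesis using e mT by (auto simp: multigraph_def)
    qed
  qed
  moreover have "set es \<subseteq> edges T" using g e by (auto simp: es_def h_def)
  moreover have "ends T (es ! i) = {p ! i, p ! ((i + 1) mod length p)}" if "i < length p" for i
  proof (cases "Suc i < length p")
    case True then show ?thesis using g[of i] by (simp add: es_def h_def)
  next
    case False
    then have "i = length p - 1" using that by auto
    then have "p ! i = b" "p ! ((i + 1) mod length p) = a"
      using p that by (auto simp: last_conv_nth hd_conv_nth)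
    then show ?thesis using False that e by (auto simp: es_def h_def)
  qed
  ultimately have "is_cycle T p es" using len p(4) by (simp add: is_cycle_def es_def)
  then show False using T by (auto simp: is_tree_def)
qed

text \<open>The rest of a cycle joins the ends of its edge \<open>es ! 0\<close>. Bridges are the
  convenient form of acyclicity when a tree is modified, since the edges can be checked one at a
  time.\<close>

lemma bridges_no_cycle:
  assumes "\<And>e a b. e \<in> edges T \<Longrightarrow> ends T e = {a, b} \<Longrightarrow> \<not> connected_in (delete_edge T e) a b"
  shows "\<not> is_cycle T xs es"
proof
  assume "is_cycle T xs es"
  then have c: "length xs \<ge> 2" "length es = length xs" "distinct es" "set es \<subseteq> edges T"
    "\<And>i. i < length xs \<Longrightarrow> ends T (es ! i) = {xs ! i, xs ! ((i + 1) mod length xs)}"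
    by (auto simp: is_cycle_def)
  have pos: "0 < length xs" "1 < length xs" using c(1) by auto
  have e0: "es ! 0 \<in> edges T" "ends T (es ! 0) = {xs ! 0, xs ! 1}"
    using c(2,4) c(5)[OF pos(1)] pos nth_mem[of 0 es] by auto
  have step: "adjacent (delete_edge T (es ! 0)) (xs ! i) (xs ! ((i + 1) mod length xs))"
    if "i < length xs" "i \<noteq> 0" for i
  proof (rule adjacent_delete_edgeI)
    show "es ! i \<in> edges T" using that c nth_mem[of i es] by auto
    show "es ! i \<noteq> es ! 0" using that c(2,3) pos by (simp add: nth_eq_iff_index_eq)
    show "ends T (es ! i) = {xs ! i, xs ! ((i + 1) mod length xs)}" using c(5) that by blast
  qed
  have "Suc j < length xs \<Longrightarrow> connected_in (delete_edge T (es ! 0)) (xs ! 1) (xs ! Suc j)" for j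
  proof (induction j)
    case (Suc j)
    then have "adjacent (delete_edge T (es ! 0)) (xs ! Suc j) (xs ! Suc (Suc j))"
      using step[of "Suc j"] by simp
    then show ?case using Suc by (meson Suc_lessD connected_in_adjacent connected_in_trans)
  qed simp
  from this[of "length xs - 2"] c(1)
  have "connected_in (delete_edge T (es ! 0)) (xs ! 1) (xs ! (length xs - 1))"
    by (simp add: numeral_2_eq_2 Suc_diff_Suc)
  moreover have "adjacent (delete_edge T (es ! 0)) (xs ! (length xs - 1)) (xs ! 0)"
    using step[of "length xs - 1"] pos by simp
  ultimately have "connected_in (delete_edge T (es ! 0)) (xs ! 0) (xs ! 1)"
    by (meson connected_in_adjacent connected_in_sym connected_in_trans)
  then show False using assms e0 by blast
qed

lemma is_treeI:
  assumes "multigraph T" "verts T \<noteq> {}" "\<And>s t. s \<in> verts T \<Longrightarrow> t \<in> verts T \<Longrightarrow> connected_in T s t"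
    and "\<And>e a b. e \<in> edges T \<Longrightarrow> ends T e = {a, b} \<Longrightarrow> \<not> connected_in (delete_edge T e) a b"
  shows "is_tree T"
  using assms bridges_no_cycle[of T] by (auto simp: is_tree_def)

section \<open>The two components of a tree minus an edge\<close>

lemma connected_delete_edge_ends:
  assumes "connected_in T a x" "ends T f = {a, b}"
  shows "connected_in (delete_edge T f) x a \<or> connected_in (delete_edge T f) x b"
  using assms(1) unfolding connected_in_def[of T]
proof (induction rule: rtranclp_induct)
  case (step y z)
  then obtain e where e: "e \<in> edges T" "ends T e = {y, z}" by (auto simp: adjacent_def)
  show ?case
  proof (cases "e = f")
    case True
    then have "z = a \<or> z = b" using e assms(2) by (auto simp: doubleton_eq_iff)
    then show ?thesis by auto
  next
    case False
    then have "connected_in (delete_edge T f) z y"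
      using e by (meson adjacent_delete_edgeI connected_in_adjacent connected_in_sym)
    then show ?thesis using step.IH by (meson connected_in_trans)
  qed
qed simp

lemma is_tree_multigraph: "is_tree T \<Longrightarrow> multigraph T"
  by (simp add: is_tree_def)

lemma is_tree_incidentE:
  assumes "is_tree T" "f \<in> incident_edges T t"
  obtains s where "f \<in> edges T" "ends T f = {t, s}" "t \<noteq> s" "t \<in> verts T" "s \<in> verts T"
  using multigraph_incidentE[OF is_tree_multigraph[OF assms(1)] assms(2)] by blast

text \<open>Deleting \<open>f\<close> leaves only two components, that of \<open>t\<close> and that
  of the other end. Connectivity in \<open>delete_edge T f\<close> thus becomes a yes-or-no question
  about each single node, which \<open>side\<close> records.\<close>

lemma connected_delete_edge_iff:
  assumes T: "is_tree T" and f: "f \<in> incident_edges T t" and "x \<in> verts T" "y \<in> verts T"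
  shows "connected_in (delete_edge T f) x y \<longleftrightarrow>
    (connected_in (delete_edge T f) x t \<longleftrightarrow> connected_in (delete_edge T f) y t)"
proof -
  obtain s where s: "ends T f = {t, s}" "t \<in> verts T"
    using is_tree_incidentE[OF T f] by blast
  have "connected_in (delete_edge T f) z t \<or> connected_in (delete_edge T f) z s" if "z \<in> verts T" for z
    using T that s by (intro connected_delete_edge_ends) (auto simp: is_tree_def)
  with assms(3,4) show ?thesis by (meson connected_in_sym connected_in_trans)
qed

text \<open>Every node on a walk from \<open>t\<close> remains joined to \<open>t\<close> after
  deletion of \<open>f\<close> or after deletion of \<open>f'\<close>: if the walk uses one of these
  edges, it does so at \<open>t\<close>, and that edge survives the deletion of the other.\<close>

lemma separating_edge_unique:
  assumes T: "is_tree T" and f: "f \<in> incident_edges T t" "f' \<in> incident_edges T t" and x: "x \<in> verts T"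
    and sep: "\<not> connected_in (delete_edge T f) x t" "\<not> connected_in (delete_edge T f') x t"
  shows "f = f'"
proof (rule ccontr)
  assume ne: "f \<noteq> f'"
  obtain s where s: "f \<in> edges T" "ends T f = {t, s}" "t \<in> verts T" 
    using is_tree_incidentE[OF T f(1)] by blast
  obtain s' where s': "f' \<in> edges T" "ends T f' = {t, s'}"
    using is_tree_incidentE[OF T f(2)] by blast
  have "connected_in T t x" using T x s by (auto simp: is_tree_def)
  then have "connected_in (delete_edge T f) x t \<or> connected_in (delete_edge T f') x t"
    unfolding connected_in_def[of T]
  proof (induction rule: rtranclp_induct)
    case (step y z)
    then obtain e where e: "e \<in> edges T" "ends T e = {y, z}" by (auto simp: adjacent_def)
    have zy: "connected_in (delete_edge T g) z y" if "e \<noteq> g" for g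
      using e that by (meson adjacent_delete_edgeI connected_in_adjacent connected_in_sym)
    consider "e \<noteq> f \<and> e \<noteq> f'" | "e = f" | "e = f'" by blast
    then show ?case
    proof cases
      case 1 then show ?thesis using step.IH zy by (meson connected_in_trans)
    next
      case 2
      then have "z = t \<or> y = t" using e s by (auto simp: doubleton_eq_iff)
      then show ?thesis using zy[of f'] 2 ne by auto
    next
      case 3
      then have "z = t \<or> y = t" using e s' by (auto simp: doubleton_eq_iff)
      then show ?thesis using zy[of f] 3 ne by auto
    qed
  qed simp
  then show False using sep by blast
qed

text \<open>The witness is the edge by which a walk from \<open>t\<close> to \<open>x\<close> last
  leaves \<open>t\<close>; it separates because it is a bridge.\<close>

lemma separating_edge_exists:
  assumes T: "is_tree T" and "t \<in> verts T" "x \<in> verts T" "x \<noteq> t"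
  shows "\<exists>f \<in> incident_edges T t. \<not> connected_in (delete_edge T f) x t"
proof -
  have "connected_in T t x" using T assms by (auto simp: is_tree_def)
  then have "x = t \<or> (\<exists>f \<in> incident_edges T t. \<not> connected_in (delete_edge T f) x t)"
    unfolding connected_in_def[of T]
  proof (induction rule: rtranclp_induct)
    case (step y z)
    then obtain e where e: "e \<in> edges T" "ends T e = {y, z}" by (auto simp: adjacent_def)
    show ?case
    proof (cases "y = t")
      case True
      then have "\<not> connected_in (delete_edge T e) z t"
        using is_tree_bridge[OF T e] by (metis connected_in_sym)
      moreover have "e \<in> incident_edges T t" using e True by (simp add: incident_edges_def)
      ultimately show ?thesis by blast
    next
      case False
      then obtain f where f: "f \<in> incident_edges T t" "\<not> connected_in (delete_edge T f) y t"
        using step.IH by blast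
      show ?thesis
      proof (cases "e = f")
        case True
        then have "t \<in> {y, z}" using f e by (simp add: incident_edges_def)
        then show ?thesis using False by simp
      next
        case ef: False
        then have "connected_in (delete_edge T f) y z"
          using e by (meson adjacent_delete_edgeI connected_in_adjacent)
        then have "\<not> connected_in (delete_edge T f) z t" using f(2) by (metis connected_in_trans)
        then show ?thesis using f(1) by blast
      qed
    qed
  qed simp
  then show ?thesis using assms by blast
qed

section \<open>Paths in trees\<close>

lemma is_tree_path_exists:
  assumes "is_tree T" "x \<in> verts T" "y \<in> verts T"
  shows "\<exists>p. is_path T x p y"
proof -
  have "(adjacent T)\<^sup>*\<^sup>* x y" using assms by (auto simp: is_tree_def connected_in_def)
  then obtain p where p: "p \<noteq> []" "hd p = x" "last p = y" "distinct p" "successively (adjacent T) p"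
    by (rule rtranclp_obtain_distinct)
  have "z \<in> verts T" if z: "z \<in> set p" for z
  proof -
    obtain q r where "p = q @ z # r" using z by (auto simp: in_set_conv_decomp)
    then have "(adjacent T)\<^sup>*\<^sup>* x z"
      using p successively_rtranclp[of "adjacent T" "q @ [z]"]
      by (auto simp: successively_append_iff hd_append split: if_splits)
    then show ?thesis
      using assms by (induction rule: rtranclp_induct) (auto simp: is_tree_def dest: multigraph_adjacent_verts)
  qed
  then show ?thesis using p by (auto simp: is_path_def)
qed

text \<open>If the two paths left \<open>x\<close> by different edges, \<open>q\<close> would avoid
  the first edge of \<open>p\<close>, since it meets \<open>x\<close> only at its start. Then
  \<open>q\<close> and the rest of \<open>p\<close> would join the two ends of that edge without
  using it.\<close>

lemma is_tree_path_unique: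
  assumes T: "is_tree T" and "is_path T x p y" "is_path T x q y"
  shows "p = q"
  using assms(2,3)
proof (induction p arbitrary: x q)
  case Nil
  then show ?case by (simp add: is_path_def)
next
  case (Cons x' p)
  have [simp]: "x' = x" using Cons.prems by (simp add: is_path_def)
  obtain q' where q: "q = x # q'" using Cons.prems by (cases q) (auto simp: is_path_def)
  show ?case
  proof (cases "p = []")
    case True
    then have "x = y" using Cons.prems by (simp add: is_path_def)
    then have "q' = []" using Cons.prems q by (auto simp: is_path_def split: if_splits)
    then show ?thesis using True q by simp
  next
    case False
    then obtain c p' where p: "p = c # p'" by (cases p) auto
    have "x \<noteq> y" using Cons.prems False by (auto simp: is_path_def)
    then obtain d q'' where q': "q' = d # q''" using Cons.prems q by (cases q') (auto simp: is_path_def)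
    obtain f where f: "f \<in> edges T" "ends T f = {x, c}"
      using Cons.prems p by (auto simp: is_path_def adjacent_def)
    have "connected_in (delete_edge T f) c y"
      using successively_connected_in[of "delete_edge T f" p] successively_avoiding_vertex[of T p f x c]
        Cons.prems p f by (auto simp: is_path_def)
    then have sep: "\<not> connected_in (delete_edge T f) x y"
      using is_tree_bridge[OF T f] by (meson connected_in_sym connected_in_trans)
    have "c = d"
    proof (rule ccontr)
      assume "c \<noteq> d"
      have "successively (adjacent (delete_edge T f)) q"
      proof (rule successively_avoiding_edge)
        show "successively (adjacent T) q" using Cons.prems by (simp add: is_path_def)
        show "ends T f = {x, c}" by fact
        fix i assume i: "Suc i < length q"
        have "distinct q" using Cons.prems by (simp add: is_path_def)
        show "{q ! i, q ! Suc i} \<noteq> {x, c}"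
        proof
          assume eq: "{q ! i, q ! Suc i} = {x, c}"
          then have "q ! i = q ! 0 \<or> q ! Suc i = q ! 0" using q by (auto simp: doubleton_eq_iff)
          then have "i = 0" using \<open>distinct q\<close> i nth_eq_iff_index_eq[of q i 0] nth_eq_iff_index_eq[of q "Suc i" 0]
            by fastforce
          then show False using eq q q' \<open>c \<noteq> d\<close> by (auto simp: doubleton_eq_iff)
        qed
      qed
      then have "connected_in (delete_edge T f) x y"
        using successively_connected_in[of "delete_edge T f" q] Cons.prems by (auto simp: is_path_def)
      then show False using sep by blast
    qed
    then have "is_path T c p y" "is_path T c q' y"
      using Cons.prems p q q' by (auto simp: is_path_def)
    then show ?thesis using Cons.IH q by auto
  qed
qed

text \<open>This turns statements about paths into statements about separating edges. The edge of
  the path next to \<open>t\<close> separates its ends; the first disjunct is the path with the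
  single node \<open>t\<close>, whose ends no edge separates.\<close>

lemma is_path_mem_iff:
  assumes T: "is_tree T" and p: "is_path T x p y"
  shows "t \<in> set p \<longleftrightarrow> x = t \<and> y = t \<or>
    (\<exists>f \<in> incident_edges T t. \<not> connected_in (delete_edge T f) x y)"
proof
  have P: "p \<noteq> []" "hd p = x" "last p = y" "distinct p" "successively (adjacent T) p"
    using p by (auto simp: is_path_def)
  {
    assume "t \<in> set p"
    then obtain p1 p2 where p12: "p = p1 @ t # p2" by (auto simp: in_set_conv_decomp)
    show "x = t \<and> y = t \<or> (\<exists>f \<in> incident_edges T t. \<not> connected_in (delete_edge T f) x y)"
    proof (cases p2)
      case (Cons c p3)
      then obtain f where f: "f \<in> edges T" "ends T f = {t, c}"
        using P p12 by (auto simp: successively_append_iff adjacent_def)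
      have "successively (adjacent (delete_edge T f)) (p1 @ [t])"
        using P p12 Cons f
        by (intro successively_avoiding_vertex[of T _ f c t]) (auto simp: successively_append_iff insert_commute)
      from successively_connected_in[OF this] have 1: "connected_in (delete_edge T f) x t"
        using P p12 by (auto simp: hd_append split: if_splits)
      have "successively (adjacent (delete_edge T f)) p2"
        using P p12 Cons f
        by (intro successively_avoiding_vertex[of T _ f t c]) (auto simp: successively_append_iff)
      from successively_connected_in[OF this] have "connected_in (delete_edge T f) c y"
        using P p12 Cons by auto
      with 1 is_tree_bridge[OF T f] have "\<not> connected_in (delete_edge T f) x y"
        by (meson connected_in_sym connected_in_trans)
      then show ?thesis using f by (auto simp: incident_edges_def)
    next
      case Nil
      then have "y = t" using P p12 by simp
      show ?thesis
      proof (cases p1 rule: rev_cases)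
        case Nil
        then show ?thesis using P p12 \<open>y = t\<close> by auto
      next
        case (snoc p3 c)
        then obtain f where f: "f \<in> edges T" "ends T f = {t, c}"
          using P p12 by (auto simp: successively_append_iff adjacent_def insert_commute)
        have "successively (adjacent (delete_edge T f)) p1"
          using P p12 f
          by (intro successively_avoiding_vertex[of T _ f t c]) (auto simp: successively_append_iff)
        from successively_connected_in[OF this] have "connected_in (delete_edge T f) x c"
          using P p12 snoc by (auto simp: hd_append split: if_splits)
        with is_tree_bridge[OF T f] have "\<not> connected_in (delete_edge T f) x y"
          using \<open>y = t\<close> by (meson connected_in_sym connected_in_trans)
        then show ?thesis using f by (auto simp: incident_edges_def)
      qed
    qed
  }
  {
    assume h: "x = t \<and> y = t \<or> (\<exists>f \<in> incident_edges T t. \<not> connected_in (delete_edge T f) x y)"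
    show "t \<in> set p"
    proof (rule ccontr)
      assume t: "t \<notin> set p"
      then have "x \<noteq> t" using P by auto
      then obtain f where f: "f \<in> incident_edges T t" "\<not> connected_in (delete_edge T f) x y"
        using h by blast
      obtain s where "ends T f = {t, s}"
        using is_tree_incidentE[OF T f(1)] by blast
      then have "connected_in (delete_edge T f) x y"
        using successively_connected_in[OF successively_avoiding_vertex[OF P(5) _ t]] P by auto
      then show False using f by blast
    qed
  }
qed

section \<open>Moving edges of a tree to a new node\<close>

text \<open>Moved edges keep their names and only exchange the end \<open>t\<close> for
  \<open>n\<close>, so that sides and adhesions can be compared edge by edge between the two
  trees.\<close>

definition regroup :: "('n, 'f) mgraph \<Rightarrow> 'n \<Rightarrow> 'f set \<Rightarrow> 'n \<Rightarrow> 'f \<Rightarrow> ('n, 'f) mgraph" where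
  "regroup T t S n f =
     \<lparr>verts = insert n (verts T), edges = insert f (edges T),
      ends = (\<lambda>e. if e = f then {t, n} else if e \<in> S then insert n (ends T e - {t}) else ends T e)\<rparr>"

locale regrouping =
  fixes T :: "('n, 'f) mgraph" and t n :: 'n and S :: "'f set" and f :: 'f
  assumes T: "is_tree T" and t: "t \<in> verts T" and S: "S \<subseteq> incident_edges T t"
    and n: "n \<notin> verts T" and f: "f \<notin> edges T"
begin

abbreviation T' where "T' \<equiv> regroup T t S n f"

lemma verts_regroup [simp]: "verts T' = insert n (verts T)"
  and edges_regroup [simp]: "edges T' = insert f (edges T)"
  and ends_new: "ends T' f = {t, n}"
  and ends_unmoved: "e \<in> edges T \<Longrightarrow> e \<notin> S \<Longrightarrow> ends T' e = ends T e"
  using f by (auto simp: regroup_def)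

lemma new_distinct: "n \<noteq> t" using n t by blast

lemma movedE:
  assumes "e \<in> S"
  obtains s where "e \<in> edges T" "ends T e = {t, s}" "s \<noteq> t" "s \<noteq> n" "s \<in> verts T" "ends T' e = {n, s}"
proof -
  obtain s where s: "e \<in> edges T" "ends T e = {t, s}" "t \<noteq> s" "s \<in> verts T"
    using is_tree_incidentE[OF T] assms S by blast
  moreover have "ends T' e = {n, s}" using assms s f by (auto simp: regroup_def)
  moreover have "s \<noteq> n" using s n by blast
  ultimately show ?thesis using that by blast
qed

lemma incident_regroup:
  assumes "s \<in> verts T" "s \<noteq> t"
  shows "incident_edges T' s = incident_edges T s"
proof -
  have "e \<in> edges T \<Longrightarrow> s \<in> ends T' e \<longleftrightarrow> s \<in> ends T e" for e
    by (cases "e \<in> S") (use assms n in \<open>auto simp: ends_unmoved elim!: movedE\<close>)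
  moreover have "s \<notin> ends T' f" using assms n by (auto simp: ends_new)
  ultimately show ?thesis by (auto simp: incident_edges_def)
qed

lemma incident_regroup_center: "incident_edges T' t = insert f (incident_edges T t - S)"
proof -
  have "e \<in> edges T \<Longrightarrow> t \<in> ends T' e \<longleftrightarrow> t \<in> ends T e \<and> e \<notin> S" for e
    by (cases "e \<in> S") (use new_distinct in \<open>auto simp: ends_unmoved elim!: movedE\<close>)
  then show ?thesis by (auto simp: incident_edges_def ends_new)
qed

lemma incident_regroup_new: "incident_edges T' n = insert f S"
proof -
  have "e \<in> edges T \<Longrightarrow> n \<in> ends T' e \<longleftrightarrow> e \<in> S" for e
  proof (cases "e \<in> S")
    case False
    assume e: "e \<in> edges T"
    then have "ends T e \<subseteq> verts T" using is_tree_multigraph[OF T] by (simp add: multigraph_def)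
    then show ?thesis using e False n by (auto simp: ends_unmoved)
  qed (auto elim!: movedE)
  moreover have "S \<subseteq> edges T" using S by (auto simp: incident_edges_def)
  ultimately show ?thesis by (auto simp: incident_edges_def ends_new)
qed

lemma multigraph_regroup: "multigraph T'"
proof -
  have "ends T' e \<subseteq> verts T' \<and> card (ends T' e) = 2" if e: "e \<in> edges T'" for e
  proof -
    consider "e = f" | "e \<in> S" | "e \<in> edges T" "e \<notin> S" using e by auto
    then show ?thesis
    proof cases
      case 1 then show ?thesis using t new_distinct by (simp add: ends_new)
    next
      case 2 then show ?thesis by (elim movedE) auto
    next
      case 3 then show ?thesis using is_tree_multigraph[OF T] by (auto simp: ends_unmoved multigraph_def)
    qed
  qed
  then show ?thesis using is_tree_multigraph[OF T] by (simp add: multigraph_def)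
qed

text \<open>Contracting the new edge \<open>f\<close> turns the new tree back into \<open>T\<close>;
  this is the contraction on nodes. It carries connections in the new tree back to
  \<open>T\<close>.\<close>

definition proj where "proj x = (if x = n then t else x)"

lemma proj_old: "x \<in> verts T \<Longrightarrow> proj x = x" using n by (auto simp: proj_def)

lemma connected_regroup_proj:
  assumes "e \<in> edges T" "connected_in (delete_edge T' e) x y"
  shows "connected_in (delete_edge T e) (proj x) (proj y)"
  using assms(2) unfolding connected_in_def[of "delete_edge T' e"]
proof (induction rule: rtranclp_induct)
  case (step y z)
  from step.hyps(2) obtain g where g: "g \<in> edges T'" "g \<noteq> e" "ends T' g = {y, z}"
    by (rule adjacent_delete_edgeE)
  have "connected_in (delete_edge T e) (proj y) (proj z)"
  proof -
    consider "g = f" | "g \<in> S" | "g \<in> edges T" "g \<notin> S" using g by auto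
    then show ?thesis
    proof cases
      case 1
      then have "proj y = t" "proj z = t" using g by (auto simp: ends_new proj_def doubleton_eq_iff)
      then show ?thesis by simp
    next
      case 2
      then obtain s where s: "g \<in> edges T" "ends T g = {t, s}" "s \<noteq> t" "s \<noteq> n" "ends T' g = {n, s}"
        by (rule movedE) blast
      then have "{proj y, proj z} = {t, s}" using g by (auto simp: proj_def doubleton_eq_iff)
      then have "adjacent (delete_edge T e) (proj y) (proj z)"
        using s g by (intro adjacent_delete_edgeI[of g]) simp_all
      then show ?thesis by (rule connected_in_adjacent)
    next
      case 3
      then have "ends T g = {y, z}" using g by (simp add: ends_unmoved)
      moreover from this have "y \<in> verts T" "z \<in> verts T"
        using is_tree_multigraph[OF T] 3 by (auto simp: multigraph_def)
      ultimately have "adjacent (delete_edge T e) (proj y) (proj z)"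
        using 3 g by (intro adjacent_delete_edgeI[of g]) (simp_all add: proj_old)
      then show ?thesis by (rule connected_in_adjacent)
    qed
  qed
  with step.IH show ?case by (rule connected_in_trans)
qed simp

lemma connected_regroup_lift:
  assumes "connected_in (delete_edge T e) x y" "e \<noteq> f"
  shows "connected_in (delete_edge T' e) x y"
  using assms(1) unfolding connected_in_def[of "delete_edge T e"]
proof (induction rule: rtranclp_induct)
  case (step y z)
  from step.hyps(2) obtain g where g: "g \<in> edges T" "g \<noteq> e" "ends T g = {y, z}"
    by (rule adjacent_delete_edgeE)
  have "connected_in (delete_edge T' e) y z"
  proof (cases "g \<in> S")
    case False
    then show ?thesis using g
      by (intro connected_in_adjacent adjacent_delete_edgeI[of g]) (auto simp: ends_unmoved)
  next
    case True
    then obtain s where s: "g \<in> edges T" "ends T g = {t, s}" "ends T' g = {n, s}"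
      by (rule movedE) blast
    have 1: "connected_in (delete_edge T' e) t n"
      using assms(2) by (intro connected_in_adjacent adjacent_delete_edgeI[of f]) (auto simp: ends_new)
    have 2: "connected_in (delete_edge T' e) n s"
      using s g by (intro connected_in_adjacent adjacent_delete_edgeI[of g]) auto
    have "connected_in (delete_edge T' e) t s" using 1 2 by (rule connected_in_trans)
    moreover have "y = t \<and> z = s \<or> y = s \<and> z = t" using s g by (auto simp: doubleton_eq_iff)
    ultimately show ?thesis using connected_in_sym by metis
  qed
  with step.IH show ?case by (rule connected_in_trans)
qed simp

lemma connected_regroup_old_iff:
  assumes "e \<in> edges T" "x \<in> verts T" "y \<in> verts T"
  shows "connected_in (delete_edge T' e) x y \<longleftrightarrow> connected_in (delete_edge T e) x y"
proof
  show "connected_in (delete_edge T' e) x y \<Longrightarrow> connected_in (delete_edge T e) x y"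
    using connected_regroup_proj[of e x y] assms by (simp add: proj_old)
  show "connected_in (delete_edge T e) x y \<Longrightarrow> connected_in (delete_edge T' e) x y"
    using connected_regroup_lift assms f by blast
qed

text \<open>The component of \<open>n\<close> after deletion of \<open>f\<close>, described inside
  the old tree: apart from \<open>n\<close>, the nodes that hung on a moved edge.\<close>

definition W where
  "W = insert n {x \<in> verts T. \<exists>g\<in>S. \<not> connected_in (delete_edge T g) x t}"

lemma center_notin_W: "t \<notin> W"
  using new_distinct by (auto simp: W_def)

text \<open>An edge in \<open>S\<close> has both its new ends in \<open>W\<close>. An edge outside
  \<open>S\<close> stays usable when a moved edge is deleted from \<open>T\<close>, so its two ends
  are cut off from \<open>t\<close> by the same members of \<open>S\<close>.\<close>

lemma connected_regroup_W:
  assumes "connected_in (delete_edge T' f) x y"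
  shows "x \<in> W \<longleftrightarrow> y \<in> W"
  using assms unfolding connected_in_def
proof (induction rule: rtranclp_induct)
  case (step y z)
  then obtain g where g: "g \<in> edges T" "g \<noteq> f" "ends T' g = {y, z}"
    by (auto elim!: adjacent_delete_edgeE)
  have "y \<in> W \<longleftrightarrow> z \<in> W"
  proof (cases "g \<in> S")
    case True
    then obtain s where s: "g \<in> edges T" "ends T g = {t, s}" "s \<in> verts T" "ends T' g = {n, s}"
      by (rule movedE) blast
    have "\<not> connected_in (delete_edge T g) s t"
      using is_tree_bridge[OF T s(1,2)] by (metis connected_in_sym)
    then have "s \<in> W" using s True by (auto simp: W_def)
    moreover have "n \<in> W" by (simp add: W_def)
    ultimately show ?thesis using s g by (auto simp: doubleton_eq_iff)
  next
    case False
    then have gyz: "ends T g = {y, z}" using g by (simp add: ends_unmoved)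
    then have yz: "y \<in> verts T" "z \<in> verts T"
      using is_tree_multigraph[OF T] g by (auto simp: multigraph_def)
    have "connected_in (delete_edge T h) y t \<longleftrightarrow> connected_in (delete_edge T h) z t" if "h \<in> S" for h
    proof -
      have "connected_in (delete_edge T h) y z"
        using that False g gyz by (intro connected_in_adjacent adjacent_delete_edgeI[of g]) auto
      then show ?thesis by (metis connected_in_sym connected_in_trans)
    qed
    then show ?thesis using yz n by (auto simp: W_def)
  qed
  with step.IH show ?case by simp
qed simp

lemma connected_regroup: "x \<in> verts T' \<Longrightarrow> y \<in> verts T' \<Longrightarrow> connected_in T' x y"
proof -
  have *: "connected_in T' t x" if "x \<in> verts T'" for x
  proof (cases "x = n")
    case True
    then show ?thesis by (intro connected_in_adjacent adjacentI[of f]) (simp_all add: ends_new)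
  next
    case False
    then have "connected_in T t x" using that T t by (auto simp: is_tree_def)
    then show ?thesis
      unfolding connected_in_def[of T]
    proof (induction rule: rtranclp_induct)
      case (step y z)
      then obtain g where g: "g \<in> edges T" "ends T g = {y, z}" by (auto simp: adjacent_def)
      have "connected_in T' y z"
      proof (cases "g \<in> S")
        case False
        then show ?thesis using g
          by (intro connected_in_adjacent adjacentI[of g]) (simp_all add: ends_unmoved)
      next
        case True
        then obtain s where s: "ends T g = {t, s}" "ends T' g = {n, s}"
          by (rule movedE) blast
        have "adjacent T' t n" "adjacent T' n s"
          using s g by (auto intro: adjacentI[of f] adjacentI[of g] simp: ends_new)
        then have "connected_in T' t s" by (meson connected_in_adjacent connected_in_trans)
        moreover have "y = t \<and> z = s \<or> y = s \<and> z = t" using s g by (auto simp: doubleton_eq_iff)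
        ultimately show ?thesis using connected_in_sym by metis
      qed
      with step.IH show ?case by (rule connected_in_trans)
    qed simp
  qed
  show "x \<in> verts T' \<Longrightarrow> y \<in> verts T' \<Longrightarrow> connected_in T' x y"
    using * connected_in_sym connected_in_trans by metis
qed

lemma is_tree_regroup: "is_tree T'"
proof (rule is_treeI)
  fix e a b assume e: "e \<in> edges T'" "ends T' e = {a, b}"
  consider "e = f" | "e \<in> S" | "e \<in> edges T" "e \<notin> S" using e by auto
  then show "\<not> connected_in (delete_edge T' e) a b"
  proof cases
    case 1
    then have "a \<in> W \<longleftrightarrow> b \<notin> W" using e center_notin_W by (auto simp: ends_new doubleton_eq_iff W_def)
    then show ?thesis using 1 connected_regroup_W by blast
  next
    case 2
    then obtain s where s: "e \<in> edges T" "ends T e = {t, s}" "s \<noteq> n" "ends T' e = {n, s}"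
      by (rule movedE) blast
    then have "\<not> connected_in (delete_edge T' e) n s"
      using connected_regroup_proj[of e n s] is_tree_bridge[OF T s(1,2)] by (auto simp: proj_def)
    then show ?thesis using e s connected_in_sym by (metis doubleton_eq_iff)
  next
    case 3
    then have ab: "ends T e = {a, b}" using e by (simp add: ends_unmoved)
    then have "a \<in> verts T" "b \<in> verts T"
      using is_tree_multigraph[OF T] 3 by (auto simp: multigraph_def)
    then show ?thesis using connected_regroup_old_iff 3 is_tree_bridge[OF T 3(1) ab] by blast
  qed
qed (use multigraph_regroup connected_regroup in auto)

lemma connected_regroup_new_iff:
  assumes "x \<in> verts T"
  shows "connected_in (delete_edge T' f) x t \<longleftrightarrow> (\<forall>g\<in>S. connected_in (delete_edge T g) x t)"
proof -
  have "connected_in (delete_edge T' f) x t \<longleftrightarrow> x \<notin> W"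
  proof -
    have "connected_in (delete_edge T' f) x t \<or> connected_in (delete_edge T' f) x n"
      using assms t by (intro connected_delete_edge_ends connected_regroup) (auto simp: ends_new)
    moreover have "n \<in> W" by (simp add: W_def)
    ultimately show ?thesis
      using connected_regroup_W[of x t] connected_regroup_W[of x n] center_notin_W by blast
  qed
  then show ?thesis using assms n by (auto simp: W_def)
qed

end

section \<open>Sides, torsos and contractions\<close>

lemma trace_mem_iff:
  assumes T: "is_tree T" and xy: "node_of T X u \<in> verts T" "node_of T X v \<in> verts T"
  shows "t \<in> set (trace T X u v) \<longleftrightarrow> node_of T X u = t \<and> node_of T X v = t \<or>
    (\<exists>f \<in> incident_edges T t. \<not> connected_in (delete_edge T f) (node_of T X u) (node_of T X v))"
proof -
  obtain p where p: "is_path T (node_of T X u) p (node_of T X v)"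
    using is_tree_path_exists[OF T xy] by blast
  have "trace T X u v = p"
    unfolding trace_def using p is_tree_path_unique[OF T] by (intro the_equality) auto
  then show ?thesis using is_path_mem_iff[OF T p] by simp
qed

definition cut :: "('v, 'e) mgraph \<Rightarrow> 'v set \<Rightarrow> 'e set" where
  "cut G A = {e \<in> edges G. ends G e \<inter> A \<noteq> {} \<and> \<not> ends G e \<subseteq> A}"

text \<open>For \<open>f\<close> at \<open>t\<close>, the union of the bags in the component of
  \<open>T - f\<close> that does not contain \<open>t\<close>. The sides at \<open>t\<close> and
  \<open>X t\<close> form a near-partition of the vertices; the nonempty sides and the singletons
  from \<open>X t\<close> are the vertices of the torso.\<close>

definition side ::
  "('v, 'e) mgraph \<Rightarrow> ('n, 'f) mgraph \<Rightarrow> ('n \<Rightarrow> 'v set) \<Rightarrow> 'n \<Rightarrow> 'f \<Rightarrow> 'v set" where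
  "side G T X t f = {v \<in> verts G. \<not> connected_in (delete_edge T f) (node_of T X v) t}"

lemma adh_node_subset: "adh_node G T X t \<subseteq> edges G"
  by (auto simp: adh_node_def adh_edge_def)

lemma finite_adh_node: "multigraph G \<Longrightarrow> finite (adh_node G T X t)"
  by (rule finite_subset[OF adh_node_subset]) (simp add: multigraph_def)

locale tree_cut =
  fixes G :: "('v, 'e) mgraph" and T :: "('n, 'f) mgraph" and X :: "'n \<Rightarrow> 'v set"
  assumes G: "multigraph G" and decomposition: "tree_cut_decomposition G T X"
begin

lemma tree: "is_tree T"
  using decomposition by (simp add: tree_cut_decomposition_def)

lemma finite_tree: "finite (verts T)" "finite (edges T)" "verts T \<noteq> {}"
  using tree by (auto simp: is_tree_def multigraph_def)

lemma bag_subset: "t \<in> verts T \<Longrightarrow> X t \<subseteq> verts G"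
  using decomposition by (auto simp: tree_cut_decomposition_def)

lemma finite_bag: "t \<in> verts T \<Longrightarrow> finite (X t)"
  using bag_subset G by (auto simp: multigraph_def intro: finite_subset)

lemma node_of_bag:
  assumes "t \<in> verts T" "v \<in> X t"
  shows "node_of T X v = t"
  unfolding node_of_def
proof (rule the_equality)
  fix s assume "s \<in> verts T \<and> v \<in> X s"
  then show "s = t"
    using decomposition assms by (auto simp: tree_cut_decomposition_def disjoint_family_on_def)
qed (use assms in simp)

lemma node_of_verts: "v \<in> verts G \<Longrightarrow> node_of T X v \<in> verts T"
  and node_of_mem: "v \<in> verts G \<Longrightarrow> v \<in> X (node_of T X v)"
  using decomposition node_of_bag unfolding tree_cut_decomposition_def by (metis UN_E)+

lemma node_of_eq_iff: "t \<in> verts T \<Longrightarrow> v \<in> verts G \<Longrightarrow> node_of T X v = t \<longleftrightarrow> v \<in> X t"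
  using node_of_bag node_of_mem by blast

lemma incident_verts: "f \<in> incident_edges T t \<Longrightarrow> t \<in> verts T"
  using is_tree_incidentE[OF tree] by blast

lemma connected_side_iff:
  assumes "f \<in> incident_edges T t" "u \<in> verts G" "v \<in> verts G"
  shows "connected_in (delete_edge T f) (node_of T X u) (node_of T X v) \<longleftrightarrow>
    (u \<in> side G T X t f \<longleftrightarrow> v \<in> side G T X t f)"
  using connected_delete_edge_iff[OF tree assms(1) node_of_verts[OF assms(2)] node_of_verts[OF assms(3)]]
    assms(2,3) by (auto simp: side_def)

text \<open>Adhesions of tree edges become cuts of vertex sets, and by
  \<open>contraction_incident\<close> so do the edges at a vertex of a contraction. This is how
  degrees and adhesions are compared.\<close>

lemma adh_edge_cut:
  assumes f: "f \<in> incident_edges T t"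
  shows "adh_edge G T X f = cut G (side G T X t f)"
proof -
  have "(\<exists>u v. ends G e = {u, v} \<and> \<not> connected_in (delete_edge T f) (node_of T X u) (node_of T X v))
      \<longleftrightarrow> ends G e \<inter> side G T X t f \<noteq> {} \<and> \<not> ends G e \<subseteq> side G T X t f" if e: "e \<in> edges G" for e
  proof -
    obtain a b where ab: "ends G e = {a, b}" "a \<in> verts G" "b \<in> verts G"
      using multigraph_endsE[OF G e] by blast
    have "(\<exists>u v. ends G e = {u, v} \<and> \<not> connected_in (delete_edge T f) (node_of T X u) (node_of T X v))
      \<longleftrightarrow> \<not> connected_in (delete_edge T f) (node_of T X a) (node_of T X b)"
      using ab connected_in_sym by (metis doubleton_eq_iff)
    also have "\<dots> \<longleftrightarrow> \<not> (a \<in> side G T X t f \<longleftrightarrow> b \<in> side G T X t f)"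
      using connected_side_iff[OF f ab(2,3)] by simp
    also have "\<dots> \<longleftrightarrow> ends G e \<inter> side G T X t f \<noteq> {} \<and> \<not> ends G e \<subseteq> side G T X t f"
      using ab by auto
    finally show ?thesis .
  qed
  then show ?thesis by (auto simp: adh_edge_def cut_def)
qed

lemma side_subset: "side G T X t f \<subseteq> verts G"
  by (auto simp: side_def)

lemma side_disjoint:
  assumes "f \<in> incident_edges T t" "f' \<in> incident_edges T t"
    and "v \<in> side G T X t f" "v \<in> side G T X t f'"
  shows "f = f'"
  using separating_edge_unique[OF tree assms(1,2)] assms(3,4) node_of_verts by (auto simp: side_def)

lemma side_bag: "t \<in> verts T \<Longrightarrow> v \<in> X t \<Longrightarrow> v \<notin> side G T X t f"
  by (simp add: side_def node_of_bag)

lemma side_cover: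
  assumes "t \<in> verts T" "v \<in> verts G" "v \<notin> X t"
  shows "\<exists>f \<in> incident_edges T t. v \<in> side G T X t f"
  using separating_edge_exists[OF tree assms(1) node_of_verts[OF assms(2)]] assms
  by (auto simp: side_def node_of_eq_iff)

text \<open>For distinct vertices, a trace avoids \<open>t\<close> if not both lie in
  \<open>X t\<close> and no edge at \<open>t\<close> separates them. A vertex outside
  \<open>X t\<close> lies on exactly one side, and then the other one has to lie on the same
  side.\<close>

lemma torso_rel_iff:
  assumes t: "t \<in> verts T"
  shows "(u, v) \<in> torso_rel G T X t \<longleftrightarrow> u \<in> verts G \<and> v \<in> verts G \<and>
    (u = v \<or> (\<exists>f \<in> incident_edges T t. u \<in> side G T X t f \<and> v \<in> side G T X t f))"
proof (cases "u \<in> verts G \<and> v \<in> verts G \<and> u \<noteq> v")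
  case True
  then have uv: "u \<in> verts G" "v \<in> verts G" "u \<noteq> v" by auto
  have "t \<notin> set (trace T X u v) \<longleftrightarrow> \<not> (u \<in> X t \<and> v \<in> X t) \<and>
      (\<forall>f \<in> incident_edges T t. u \<in> side G T X t f \<longleftrightarrow> v \<in> side G T X t f)"
    using trace_mem_iff[OF tree node_of_verts[OF uv(1)] node_of_verts[OF uv(2)], of t]
      connected_side_iff uv by (auto simp: node_of_eq_iff[OF t])
  also have "\<dots> \<longleftrightarrow> (\<exists>f \<in> incident_edges T t. u \<in> side G T X t f \<and> v \<in> side G T X t f)"
    using side_cover[OF t uv(1)] side_cover[OF t uv(2)] side_bag[OF t] side_disjoint
    by metis
  finally show ?thesis using uv by (auto simp: torso_rel_def)
qed (auto simp: torso_rel_def)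

lemma torso_class_bag:
  assumes "t \<in> verts T" "v \<in> X t"
  shows "torso_rel G T X t `` {v} = {v}"
  using assms bag_subset[OF assms(1)] side_bag[OF assms] by (auto simp: torso_rel_iff)

lemma torso_class_side:
  assumes "f \<in> incident_edges T t" "v \<in> side G T X t f"
  shows "torso_rel G T X t `` {v} = side G T X t f"
proof -
  have t: "t \<in> verts T" using incident_verts[OF assms(1)] .
  have "(v, w) \<in> torso_rel G T X t \<longleftrightarrow> w \<in> side G T X t f" for w
    unfolding torso_rel_iff[OF t]
  proof
    assume "v \<in> verts G \<and> w \<in> verts G \<and>
      (v = w \<or> (\<exists>g\<in>incident_edges T t. v \<in> side G T X t g \<and> w \<in> side G T X t g))"
    then show "w \<in> side G T X t f" using side_disjoint[OF assms(1) _ assms(2)] assms(2) by metis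
  qed (use assms in \<open>auto simp: side_def\<close>)
  then show ?thesis by auto
qed

lemma torso_rel_class_iff:
  assumes "t \<in> verts T" "u \<in> verts G" "v \<in> verts G"
  shows "(u, v) \<in> torso_rel G T X t \<longleftrightarrow> torso_rel G T X t `` {u} = torso_rel G T X t `` {v}"
proof
  assume uv: "(u, v) \<in> torso_rel G T X t"
  then show "torso_rel G T X t `` {u} = torso_rel G T X t `` {v}"
    using torso_rel_iff[OF assms(1), of u v] torso_class_side[of _ t] by metis
next
  assume "torso_rel G T X t `` {u} = torso_rel G T X t `` {v}"
  moreover have "(v, v) \<in> torso_rel G T X t" using assms by (simp add: torso_rel_iff)
  ultimately show "(u, v) \<in> torso_rel G T X t" by blast
qed

end

text \<open>A new edge of a suppression has the name of one of the two deleted edges; contracting the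
  suppressed vertex along the other one makes every graph reached from the torso literally a quotient
  of \<open>G\<close>, up to isolated vertices.\<close>

definition contraction :: "('v, 'e) mgraph \<Rightarrow> ('v \<Rightarrow> 'w) \<Rightarrow> ('w, 'e) mgraph \<Rightarrow> bool" where
  "contraction G \<phi> H \<longleftrightarrow> finite (verts H) \<and> edges H = {e \<in> edges G. card (\<phi> ` ends G e) = 2} \<and>
     (\<forall>e\<in>edges H. ends H e = \<phi> ` ends G e \<and> ends H e \<subseteq> verts H)"

lemma contraction_multigraph: "multigraph G \<Longrightarrow> contraction G \<phi> H \<Longrightarrow> multigraph H"
  unfolding contraction_def multigraph_def by fastforce

lemma contraction_incident:
  assumes "multigraph G" "contraction G \<phi> H"
  shows "incident_edges H c = cut G {v \<in> verts G. \<phi> v = c}"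
proof -
  have "e \<in> edges H \<and> c \<in> ends H e \<longleftrightarrow>
      ends G e \<inter> {v \<in> verts G. \<phi> v = c} \<noteq> {} \<and> \<not> ends G e \<subseteq> {v \<in> verts G. \<phi> v = c}"
    if e: "e \<in> edges G" for e
  proof -
    obtain a b where ab: "ends G e = {a, b}" "a \<in> verts G" "b \<in> verts G"
      using multigraph_endsE[OF assms(1) e] by blast
    have "e \<in> edges H \<longleftrightarrow> \<phi> a \<noteq> \<phi> b"
      using assms(2) e ab by (auto simp: contraction_def card_insert_if)
    moreover have "e \<in> edges H \<Longrightarrow> ends H e = {\<phi> a, \<phi> b}"
      using assms(2) ab by (auto simp: contraction_def)
    ultimately show ?thesis using ab by auto
  qed
  moreover have "edges H \<subseteq> edges G" using assms(2) by (auto simp: contraction_def)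
  ultimately show ?thesis by (auto simp: incident_edges_def cut_def)
qed

lemma (in tree_cut) torso_contraction:
  assumes t: "t \<in> verts T"
  shows "contraction G (\<lambda>v. torso_rel G T X t `` {v}) (torso G T X t)"
proof -
  let ?R = "torso_rel G T X t"
  have "(\<exists>u v. ends G e = {u, v} \<and> (u, v) \<notin> ?R) \<longleftrightarrow> card ((\<lambda>v. ?R `` {v}) ` ends G e) = 2"
    if e: "e \<in> edges G" for e
  proof -
    obtain a b where ab: "ends G e = {a, b}" "a \<in> verts G" "b \<in> verts G"
      using multigraph_endsE[OF G e] by blast
    have "(\<exists>u v. ends G e = {u, v} \<and> (u, v) \<notin> ?R) \<longleftrightarrow> ?R `` {a} \<noteq> ?R `` {b}"
      using torso_rel_class_iff[OF t] ab by (metis doubleton_eq_iff)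
    then show ?thesis using ab by (auto simp: card_insert_if)
  qed
  moreover have "(\<lambda>v. ?R `` {v}) ` ends G e \<subseteq> verts G // ?R" if e: "e \<in> edges G" for e
    using G e by (auto simp: multigraph_def intro: quotientI)
  moreover have "finite (verts G // ?R)"
    using G by (auto simp: multigraph_def quotient_def)
  ultimately show ?thesis by (auto simp: contraction_def torso_def quotient_graph_def)
qed

lemma multigraph_neighbors: "multigraph H \<Longrightarrow> neighbors H v \<subseteq> verts H"
  by (auto simp: neighbors_def dest: multigraph_adjacent_verts)

lemma finite_neighbors: "multigraph H \<Longrightarrow> finite (neighbors H v)"
  by (rule finite_subset[OF multigraph_neighbors]) (simp_all add: multigraph_def)

lemma neighborsE:
  assumes "a \<in> neighbors H v"
  obtains e where "e \<in> incident_edges H v" "ends H e = {v, a}"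
  using assms by (auto simp: neighbors_def adjacent_def incident_edges_def)

lemma incident_neighbor:
  assumes "e \<in> incident_edges H v" "ends H e = {v, a}"
  shows "a \<in> neighbors H v"
  using assms by (auto simp: neighbors_def adjacent_def incident_edges_def)

lemma finite_incident: "multigraph H \<Longrightarrow> finite (incident_edges H v)"
  by (simp add: multigraph_def incident_edges_def)

text \<open>The edge \<open>e\<close> whose name is reused may lead to either neighbour:
  \<open>c\<close> is the one behind \<open>e\<close>, and \<open>d\<close> the one behind the edge
  \<open>e'\<close> that vanishes. Two neighbours already account for two edges, so there is no
  third.\<close>

lemma bypass_incident:
  assumes H: "multigraph H" and deg: "degree H v \<le> 2" and nb: "neighbors H v = {a, b}" "a \<noteq> b"
    and e: "e \<in> incident_edges H v"
  obtains c d e' where "{c, d} = {a, b}" "ends H e = {v, c}" "ends H e' = {v, d}" "e' \<noteq> e"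
    "incident_edges H v = {e, e'}"
proof -
  obtain c where c: "ends H e = {v, c}" using multigraph_incidentE[OF H e] by blast
  then have "c \<in> {a, b}" using incident_neighbor[OF e c] nb by simp
  then obtain d where d: "{c, d} = {a, b}" "c \<noteq> d" using nb(2) by blast
  then have "d \<in> neighbors H v" using nb by blast
  then obtain e' where e': "e' \<in> incident_edges H v" "ends H e' = {v, d}" by (rule neighborsE)
  have "e' \<noteq> e" using c e' d by (auto simp: doubleton_eq_iff)
  then have "card {e, e'} = 2" by simp
  then have "{e, e'} = incident_edges H v"
    using finite_incident[OF H] deg e e'(1) unfolding degree_def
    by (intro card_seteq) auto
  then show ?thesis using that c d e' \<open>e' \<noteq> e\<close> by metis
qed

lemma suppression_multigraph:
  assumes H: "multigraph H" and s: "suppression P H H'"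
  shows "multigraph H'"
  using s
proof cases
  case (delete v)
  then show ?thesis using H by (auto simp: multigraph_def delete_vertex_def incident_edges_def)
next
  case (bypass v a b e)
  have "a \<in> verts H - {v}" "b \<in> verts H - {v}"
  proof -
    have "x \<in> verts H - {v}" if x: "x \<in> neighbors H v" for x
    proof -
      obtain g where g: "g \<in> incident_edges H v" "ends H g = {v, x}" using x by (rule neighborsE)
      then show ?thesis using H by (auto simp: multigraph_def incident_edges_def)
    qed
    then show "a \<in> verts H - {v}" "b \<in> verts H - {v}" using bypass by auto
  qed
  then show ?thesis using H bypass
    by (auto simp: multigraph_def delete_vertex_def add_edge_def incident_edges_def)
qed

lemma suppression_contraction:
  fixes H H' :: "('w, 'e) mgraph"
  assumes G: "multigraph G" and con: "contraction G \<phi> H" and s: "suppression P H H'"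
  obtains v a where "v \<in> verts H" "v \<notin> P" "degree H v \<le> 2" "verts H' = verts H - {v}"
    "contraction G (\<lambda>x. if \<phi> x = v then a else \<phi> x) H'"
proof -
  have H: "multigraph H" using contraction_multigraph[OF G con] .
  have H': "multigraph H'" using suppression_multigraph[OF H s] .
  have edge: "e \<in> edges G \<Longrightarrow> e \<in> edges H \<longleftrightarrow> card (\<phi> ` ends G e) = 2"
    and sub: "edges H \<subseteq> edges G"
    and ends: "e \<in> edges H \<Longrightarrow> ends H e = \<phi> ` ends G e" for e
    using con by (auto simp: contraction_def)
  define m where "m v a x = (if x = v then a else x)" for v a x :: 'w
  have im: "(\<lambda>x. if \<phi> x = v then a else \<phi> x) ` A = m v a ` \<phi> ` A" for v a A
    by (auto simp: m_def image_iff)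
  have main: "contraction G (\<lambda>x. if \<phi> x = v then a else \<phi> x) H'"
    if in_H': "\<And>e. e \<in> edges H \<Longrightarrow> e \<in> edges H' \<longleftrightarrow> card (m v a ` ends H e) = 2"
      and ends': "\<And>e. e \<in> edges H' \<Longrightarrow> ends H' e = m v a ` ends H e"
      and sub': "edges H' \<subseteq> edges H" for v a
  proof -
    have "e \<in> edges H' \<longleftrightarrow> card (m v a ` \<phi> ` ends G e) = 2" if e: "e \<in> edges G" for e
    proof (cases "e \<in> edges H")
      case True then show ?thesis using in_H' ends by simp
    next
      case False
      obtain x y where "ends G e = {x, y}" using multigraph_endsE[OF G e] by blast
      then have "\<phi> x = \<phi> y" using False edge[OF e] by (auto simp: card_insert_if split: if_splits)
      then show ?thesis using False sub' \<open>ends G e = {x, y}\<close> by auto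
    qed
    moreover have "ends H' e = m v a ` \<phi> ` ends G e" if "e \<in> edges H'" for e
      using that ends ends' sub' by auto
    ultimately show ?thesis using H' sub sub'
      unfolding contraction_def im by (auto simp: multigraph_def)
  qed
  have away: "m v a ` ends H e = ends H e" if "e \<notin> incident_edges H v" "e \<in> edges H" for e v a
    using that by (auto simp: m_def incident_edges_def image_iff)
  have card2: "card (ends H e) = 2" if "e \<in> edges H" for e
    using H that by (auto simp: multigraph_def)
  from s show ?thesis
  proof cases
    case (delete v)
    have "\<forall>x\<in>neighbors H v. \<forall>y\<in>neighbors H v. x = y"
      using delete card_le_Suc0_iff_eq[OF finite_neighbors[OF H, of v]] by simp
    \<comment> \<open>Merging \<open>v\<close> into its only neighbour turns all its edges into
      loops, which a contraction drops. If \<open>v\<close> is isolated, \<open>a\<close> is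
      arbitrary and may fail to be a vertex of \<open>H'\<close>.\<close>
    then obtain a where a: "neighbors H v \<subseteq> {a}" by blast
    have "card (m v a ` ends H e) \<noteq> 2" if e: "e \<in> incident_edges H v" for e
    proof -
      obtain w where "ends H e = {v, w}" using multigraph_incidentE[OF H e] by blast
      moreover from this have "w = a" using incident_neighbor[OF e] a by blast
      ultimately show ?thesis by (simp add: m_def)
    qed
    then have "contraction G (\<lambda>x. if \<phi> x = v then a else \<phi> x) H'"
      using delete away card2
      by (intro main) (auto simp: delete_vertex_def)
    then show ?thesis using that delete by (auto simp: delete_vertex_def)
  next
    case (bypass v a b e)
    obtain c d e' where cd: "{c, d} = {a, b}" "ends H e = {v, c}" "ends H e' = {v, d}" "e' \<noteq> e"
      "incident_edges H v = {e, e'}"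
      using bypass_incident[OF H bypass(4,5,6,7)] by blast
    have e: "e \<in> edges H" "e' \<in> edges H" using cd(5) by (auto simp: incident_edges_def)
    have ne: "c \<noteq> v" "d \<noteq> v" using card2[OF e(1)] card2[OF e(2)] cd by auto
    have "c \<noteq> d" using cd(1) bypass by auto
    have ends': "ends H' e = {d, c}" "\<And>g. g \<noteq> e \<Longrightarrow> ends H' g = ends H g"
      and edges': "edges H' = insert e (edges H - {e, e'})"
      using bypass cd by (auto simp: add_edge_def delete_vertex_def)
    \<comment> \<open>\<open>v\<close> is merged into \<open>d\<close> and not into
      \<open>c\<close>: the edge \<open>e\<close> then joins \<open>d\<close> and \<open>c\<close>,
      as the added edge does, and \<open>e'\<close> becomes a loop.\<close>
    have me: "m v d ` ends H e = {d, c}" "m v d ` ends H e' = {d}" using cd ne by (auto simp: m_def)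
    have aw: "m v d ` ends H g = ends H g" if "g \<in> edges H" "g \<noteq> e" "g \<noteq> e'" for g
      using away[of g v d] that cd by auto
    have "contraction G (\<lambda>x. if \<phi> x = v then d else \<phi> x) H'"
    proof (rule main)
      fix g assume g: "g \<in> edges H"
      show "g \<in> edges H' \<longleftrightarrow> card (m v d ` ends H g) = 2"
        using g aw[of g] card2[OF g] me edges' cd(4) \<open>c \<noteq> d\<close>
        by (cases "g = e"; cases "g = e'") auto
    next
      fix g assume g: "g \<in> edges H'"
      then show "ends H' g = m v d ` ends H g"
        using edges' ends' me aw[of g] by (cases "g = e") auto
    qed (use edges' e in auto)
    then show ?thesis using that bypass by (auto simp: delete_vertex_def add_edge_def)
  qed
qed

section \<open>Replaying suppressions in the decomposition\<close>

locale tree_cut_regroup = tree_cut G T X + regrouping T t n S f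
  for G :: "('v, 'e) mgraph" and T :: "('n, 'f) mgraph" and X t n S f
begin

abbreviation X' where "X' \<equiv> X(n := {})"

lemma decomposition_regroup: "tree_cut_decomposition G T' X'"
proof -
  have "disjoint_family_on X' (verts T')"
    using decomposition by (auto simp: tree_cut_decomposition_def disjoint_family_on_def)
  moreover have "(\<Union>s\<in>verts T'. X' s) = (\<Union>s\<in>verts T. X s)" using n by auto
  ultimately show ?thesis
    using decomposition is_tree_regroup by (simp add: tree_cut_decomposition_def)
qed

lemma node_of_regroup: "v \<in> verts G \<Longrightarrow> node_of T' X' v = node_of T X v"
proof -
  assume v: "v \<in> verts G"
  interpret R: tree_cut G T' X' by unfold_locales (rule G decomposition_regroup)+
  have "node_of T X v \<noteq> n" using node_of_verts[OF v] n by blast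
  then show ?thesis using node_of_verts[OF v] node_of_mem[OF v] by (intro R.node_of_bag) auto
qed

lemma side_regroup_old:
  "s \<in> verts T \<Longrightarrow> g \<in> edges T \<Longrightarrow> side G T' X' s g = side G T X s g"
  by (auto simp: side_def node_of_regroup connected_regroup_old_iff node_of_verts)

lemma side_regroup_new: "side G T' X' t f = (\<Union>g\<in>S. side G T X t g)"
  by (auto simp: side_def node_of_regroup connected_regroup_new_iff node_of_verts)

lemma adh_edge_regroup:
  assumes "g \<in> edges T"
  shows "adh_edge G T' X' g = adh_edge G T X g"
proof -
  obtain s r where s: "ends T g = {s, r}" "s \<in> verts T" "r \<in> verts T" "s \<noteq> r"
    using multigraph_endsE[OF is_tree_multigraph[OF tree] assms] by metis
  \<comment> \<open>Regrouping replaces only the end \<open>t\<close> of a moved edge, so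
    \<open>g\<close> is still incident to an end other than \<open>t\<close>, and its sides there
    can be compared.\<close>
  obtain z where z: "z \<in> {s, r}" "z \<noteq> t" using s by blast
  then have inc: "g \<in> incident_edges T z" using s assms by (auto simp: incident_edges_def)
  interpret R: tree_cut G T' X' by unfold_locales (rule G decomposition_regroup)+
  have "z \<in> verts T" using z s by blast
  then have "g \<in> incident_edges T' z" using incident_regroup z inc by blast
  from R.adh_edge_cut[OF this] adh_edge_cut[OF inc] show ?thesis
    using assms \<open>z \<in> verts T\<close> by (simp add: side_regroup_old)
qed

lemma bold_regroup: "g \<in> edges T \<Longrightarrow> bold G T' X' g \<longleftrightarrow> bold G T X g"
  by (simp add: bold_def adh_edge_regroup)

lemma adh_node_regroup:
  assumes "s \<in> verts T" "s \<noteq> t"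
  shows "adh_node G T' X' s = adh_node G T X s"
proof -
  have "incident_edges T s \<subseteq> edges T" by (auto simp: incident_edges_def)
  then show ?thesis
    unfolding adh_node_def incident_regroup[OF assms]
    by (auto simp: bold_regroup adh_edge_regroup subset_iff)
qed

lemma torso_rel_regroup:
  assumes s: "s \<in> verts T" "s \<noteq> t"
  shows "torso_rel G T' X' s = torso_rel G T X s"
proof -
  interpret R: tree_cut G T' X' by unfold_locales (rule G decomposition_regroup)+
  have s': "s \<in> verts T'" using s by simp
  have "side G T' X' s g = side G T X s g" if "g \<in> incident_edges T s" for g
    using that s by (intro side_regroup_old) (auto simp: incident_edges_def)
  then have "(u, v) \<in> torso_rel G T' X' s \<longleftrightarrow> (u, v) \<in> torso_rel G T X s" for u v
    unfolding R.torso_rel_iff[OF s'] torso_rel_iff[OF s(1)] incident_regroup[OF s] by auto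
  then show ?thesis by auto
qed

end

section \<open>Treating one node\<close>

text \<open>What treating \<open>t\<close> may do to a decomposition: the other nodes keep bag,
  adhesion and torso, and new nodes are good at once, with k instead of k^2, so they never have to
  be treated. The adhesion bound speaks of bold edges, so that the thin edges created by regrouping
  satisfy it trivially.\<close>

definition refines_at ::
  "nat \<Rightarrow> ('v, 'e) mgraph \<Rightarrow> ('n, 'f) mgraph \<Rightarrow> ('n \<Rightarrow> 'v set) \<Rightarrow> 'n
    \<Rightarrow> ('n, 'f) mgraph \<Rightarrow> ('n \<Rightarrow> 'v set) \<Rightarrow> bool" where
  "refines_at k G T X t T' X' \<longleftrightarrow> tree_cut_decomposition G T' X' \<and>
     verts T \<subseteq> verts T' \<and> (\<forall>s\<in>verts T. X' s = X s) \<and>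
     (\<forall>s\<in>verts T' - verts T. X' s = {} \<and> card (adh_node G T' X' s) \<le> k) \<and>
     (\<forall>s\<in>verts T - {t}. adh_node G T' X' s = adh_node G T X s \<and>
        torso_rel G T' X' s = torso_rel G T X s) \<and>
     (\<forall>f\<in>edges T'. bold G T' X' f \<longrightarrow> card (adh_edge G T' X' f) \<le> k)"

lemma refines_at_trans:
  assumes "refines_at k G T X t T' X'" "refines_at k G T' X' t T'' X''" "t \<in> verts T"
  shows "refines_at k G T X t T'' X''"
proof -
  have "X'' s = {} \<and> card (adh_node G T'' X'' s) \<le> k" if "s \<in> verts T'' - verts T" for s
  proof (cases "s \<in> verts T'")
    case True
    then have "s \<in> verts T' - verts T" "s \<in> verts T' - {t}" using that assms(3) by auto
    then show ?thesis using assms(1,2) True unfolding refines_at_def by metis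
  next
    case False
    then show ?thesis using assms(2) that unfolding refines_at_def by blast
  qed
  then show ?thesis using assms unfolding refines_at_def by (auto simp: subset_iff)
qed

text \<open>\<open>\<phi>\<close> records into which vertex a vertex of \<open>G\<close> has been
  contracted so far. Bold edges at \<open>t\<close> have surviving and pairwise different values,
  which in the end bounds their number by that of the vertices of \<open>H\<close>. Thin edges are
  free to share values or to point to a vertex that is gone.\<close>

definition tracks ::
  "'w set \<Rightarrow> ('v, 'e) mgraph \<Rightarrow> ('n, 'f) mgraph \<Rightarrow> ('n \<Rightarrow> 'v set) \<Rightarrow> 'n
    \<Rightarrow> ('v \<Rightarrow> 'w) \<Rightarrow> ('w, 'e) mgraph \<Rightarrow> bool" where
  "tracks P G T X t \<phi> H \<longleftrightarrow> contraction G \<phi> H \<and> \<phi> ` X t \<subseteq> P \<and>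
     (\<forall>g\<in>incident_edges T t. \<forall>x\<in>side G T X t g. \<forall>y\<in>side G T X t g. \<phi> x = \<phi> y) \<and>
     (\<forall>g\<in>incident_edges T t. bold G T X g \<longrightarrow> (\<forall>x\<in>side G T X t g. \<phi> x \<in> verts H)) \<and>
     (\<forall>g\<in>incident_edges T t. \<forall>h\<in>incident_edges T t. bold G T X g \<longrightarrow> bold G T X h \<longrightarrow>
        (\<forall>x\<in>side G T X t g. \<forall>y\<in>side G T X t h. \<phi> x = \<phi> y \<longrightarrow> g = h))"

lemma tracks_side:
  "tracks P G T X t \<phi> H \<Longrightarrow> g \<in> incident_edges T t \<Longrightarrow> x \<in> side G T X t g \<Longrightarrow> y \<in> side G T X t g \<Longrightarrow>
    \<phi> x = \<phi> y"
  unfolding tracks_def by metis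

lemma tracks_verts:
  "tracks P G T X t \<phi> H \<Longrightarrow> g \<in> incident_edges T t \<Longrightarrow> bold G T X g \<Longrightarrow> x \<in> side G T X t g \<Longrightarrow>
    \<phi> x \<in> verts H"
  unfolding tracks_def by metis

lemma tracks_bold_unique:
  "tracks P G T X t \<phi> H \<Longrightarrow> g \<in> incident_edges T t \<Longrightarrow> h \<in> incident_edges T t \<Longrightarrow>
    bold G T X g \<Longrightarrow> bold G T X h \<Longrightarrow> x \<in> side G T X t g \<Longrightarrow> y \<in> side G T X t h \<Longrightarrow>
    \<phi> x = \<phi> y \<Longrightarrow> g = h"
  unfolding tracks_def by metis

text \<open>Nodes and edges of the tree are natural numbers here, which supplies a fresh
  \<open>n\<close> and \<open>f\<close> for every regrouping.\<close>

lemma tracks_suppression: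
  fixes T :: "(nat, nat) mgraph"
  assumes G: "multigraph G" and dec: "tree_cut_decomposition G T X" and t: "t \<in> verts T"
    and k: "\<forall>f\<in>edges T. bold G T X f \<longrightarrow> card (adh_edge G T X f) \<le> k"
    and tr: "tracks P G T X t \<phi> H" and sup: "suppression P H H'"
  shows "\<exists>T' X' \<phi>'. refines_at k G T X t T' X' \<and> tracks P G T' X' t \<phi>' H'"
proof -
  interpret tree_cut G T X using G dec by unfold_locales
  have con: "contraction G \<phi> H" using tr unfolding tracks_def by (elim conjE)
  obtain v a where v: "v \<in> verts H" "v \<notin> P" "degree H v \<le> 2" "verts H' = verts H - {v}"
    and con': "contraction G (\<lambda>x. if \<phi> x = v then a else \<phi> x) H'"
    using suppression_contraction[OF G con sup] by metis
  have XP: "\<phi> ` X t \<subseteq> P" using tr unfolding tracks_def by (elim conjE)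
  define \<phi>' where "\<phi>' = (\<lambda>x. if \<phi> x = v then a else \<phi> x)"
  define S where "S = {g \<in> incident_edges T t. \<exists>x\<in>side G T X t g. \<phi> x = v}"
  have S_side: "x \<in> side G T X t g \<Longrightarrow> \<phi> x = v" if "g \<in> S" for g x
    using that tracks_side[OF tr] unfolding S_def by blast
  obtain n where n: "n \<notin> verts T" using finite_tree(1) ex_new_if_finite infinite_UNIV_nat by blast
  obtain f where f: "f \<notin> edges T" using finite_tree(2) ex_new_if_finite infinite_UNIV_nat by blast
  interpret tree_cut_regroup G T X t n S f
    using tree t n f by unfold_locales (auto simp: S_def)
  interpret R: tree_cut G T' X' by unfold_locales (rule G decomposition_regroup)+
  have f_inc: "f \<in> incident_edges T' t" by (simp add: incident_regroup_center)
  \<comment> \<open>\<open>v\<close> lies outside \<open>P\<close>, while \<open>\<phi>\<close>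
    sends \<open>X t\<close> into \<open>P\<close>. Hence the fibre of \<open>v\<close> avoids the
    bag and is a union of whole sides, those of the edges in \<open>S\<close>.\<close>
  have blob: "side G T' X' t f = {x \<in> verts G. \<phi> x = v}"
  proof -
    have "\<exists>g\<in>S. x \<in> side G T X t g" if x: "x \<in> verts G" "\<phi> x = v" for x
    proof -
      have "x \<notin> X t" using x v(2) XP by blast
      then obtain g where "g \<in> incident_edges T t" "x \<in> side G T X t g"
        using side_cover[OF t x(1)] by blast
      then show ?thesis using x(2) unfolding S_def by blast
    qed
    moreover have "x \<in> verts G \<and> \<phi> x = v" if "g \<in> S" "x \<in> side G T X t g" for g x
      using S_side[OF that] that(2) by (simp add: side_def)
    ultimately show ?thesis unfolding side_regroup_new by blast
  qed
  \<comment> \<open>The adhesion of the new edge consists of the edges at the suppressed vertex, so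
    the degree bound in the suppression rules makes \<open>f\<close> thin.\<close>
  have "adh_edge G T' X' f = incident_edges H v"
    using R.adh_edge_cut[OF f_inc] contraction_incident[OF G con] blob by simp
  then have f_thin: "\<not> bold G T' X' f" using v(3) by (simp add: bold_def degree_def)
  have S_bold: "g = h" if gh: "g \<in> S" "h \<in> S" "bold G T X g" "bold G T X h" for g h
  proof -
    obtain x y where "x \<in> side G T X t g" "y \<in> side G T X t h" "\<phi> x = v" "\<phi> y = v"
      and "g \<in> incident_edges T t" "h \<in> incident_edges T t"
      using gh(1,2) unfolding S_def by blast
    then show ?thesis using tracks_bold_unique[OF tr _ _ gh(3,4), of x y] by simp
  qed
  have S_edges: "S \<subseteq> edges T" by (auto simp: S_def incident_edges_def)
  have "card (adh_node G T' X' n) \<le> k"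
  proof (cases "\<exists>g\<in>S. bold G T X g")
    case True
    then obtain g where g: "g \<in> S" "bold G T X g" by blast
    then have "{h \<in> incident_edges T' n. bold G T' X' h} = {g}"
      using S_bold f_thin S_edges by (auto simp: incident_regroup_new bold_regroup subset_iff)
    then have "adh_node G T' X' n = adh_edge G T X g"
      using g S_edges by (auto simp: adh_node_def adh_edge_regroup)
    then show ?thesis using g k S_edges by auto
  next
    case False
    then have "{h \<in> incident_edges T' n. bold G T' X' h} = {}"
      using f_thin S_edges by (auto simp: incident_regroup_new bold_regroup subset_iff)
    then have "adh_node G T' X' n = {}" unfolding adh_node_def by blast
    then show ?thesis by simp
  qed
  then have "refines_at k G T X t T' X'"
    using decomposition_regroup n k f_thin
    by (auto simp: refines_at_def adh_node_regroup torso_rel_regroup bold_regroup adh_edge_regroup)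
  moreover have "tracks P G T' X' t \<phi>' H'"
  proof -
    \<comment> \<open>On the side of an old edge that stays at \<open>t\<close>, no value is
      \<open>v\<close> and all values are kept. As \<open>f\<close> is thin, the conditions on bold
      edges are inherited from \<open>\<phi>\<close> and \<open>H\<close>.\<close>
    have old: "g \<in> incident_edges T t" "g \<notin> S" "side G T' X' t g = side G T X t g"
      "bold G T' X' g \<longleftrightarrow> bold G T X g" "\<And>x. x \<in> side G T X t g \<Longrightarrow> \<phi> x \<noteq> v \<and> \<phi>' x = \<phi> x"
      if "g \<in> incident_edges T' t" "g \<noteq> f" for g
    proof -
      show g: "g \<in> incident_edges T t" "g \<notin> S" using that by (auto simp: incident_regroup_center)
      then have "g \<in> edges T" by (simp add: incident_edges_def)
      then show "side G T' X' t g = side G T X t g" "bold G T' X' g \<longleftrightarrow> bold G T X g"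
        using t by (simp_all add: side_regroup_old bold_regroup)
      show "\<phi> x \<noteq> v \<and> \<phi>' x = \<phi> x" if "x \<in> side G T X t g" for x
        using that g by (auto simp: S_def \<phi>'_def)
    qed
    have "\<phi>' x = \<phi>' y" if "g \<in> incident_edges T' t" "x \<in> side G T' X' t g" "y \<in> side G T' X' t g" for g x y
    proof (cases "g = f")
      case True
      then show ?thesis using that blob by (simp add: \<phi>'_def)
    next
      case False
      then have "\<phi> x = \<phi> y" using tracks_side[OF tr] old(1,3)[OF that(1)] that(2,3) by metis
      then show ?thesis by (simp add: \<phi>'_def)
    qed
    moreover have "\<phi>' x \<in> verts H'"
      if g: "g \<in> incident_edges T' t" "bold G T' X' g" "x \<in> side G T' X' t g" for g x
    proof -
      have gf: "g \<noteq> f" using g f_thin by blast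
      then have "\<phi> x \<in> verts H" "\<phi> x \<noteq> v" "\<phi>' x = \<phi> x"
        using tracks_verts[OF tr] old[OF g(1) gf] g(2,3) by metis+
      then show ?thesis using v(4) by simp
    qed
    moreover have "g = h" if g: "g \<in> incident_edges T' t" "bold G T' X' g" "x \<in> side G T' X' t g"
      and h: "h \<in> incident_edges T' t" "bold G T' X' h" "y \<in> side G T' X' t h"
      and eq: "\<phi>' x = \<phi>' y" for g h x y
    proof -
      have ne: "g \<noteq> f" "h \<noteq> f" using g h f_thin by blast+
      have "\<phi> x = \<phi> y" using old(3,5)[OF g(1) ne(1)] old(3,5)[OF h(1) ne(2)] g(3) h(3) eq by metis
      then show ?thesis
        using tracks_bold_unique[OF tr old(1)[OF g(1) ne(1)] old(1)[OF h(1) ne(2)], of x y]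
          old(3,4)[OF g(1) ne(1)] old(3,4)[OF h(1) ne(2)] g h by metis
    qed
    moreover have "\<phi>' ` X' t \<subseteq> P"
      using XP v(2) new_distinct by (auto simp: \<phi>'_def)
    ultimately show ?thesis
      using con' unfolding tracks_def \<phi>'_def[symmetric] by (intro conjI ballI impI)
  qed
  ultimately show ?thesis by blast
qed

text \<open>At the start different nonempty sides are different classes, so the separation demanded
  of bold edges holds for all edges at \<open>t\<close>.\<close>

lemma tracks_torso:
  assumes G: "multigraph G" and dec: "tree_cut_decomposition G T X" and t: "t \<in> verts T"
  shows "tracks ((\<lambda>x. {x}) ` X t) G T X t (\<lambda>v. torso_rel G T X t `` {v}) (torso G T X t)"
proof -
  interpret tree_cut G T X using G dec by unfold_locales
  have "g = h" if "g \<in> incident_edges T t" "h \<in> incident_edges T t"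
     "x \<in> side G T X t g" "y \<in> side G T X t h" "torso_rel G T X t `` {x} = torso_rel G T X t `` {y}" for g h x y
    using that torso_class_side side_disjoint by metis
  moreover have "torso_rel G T X t `` {x} \<in> verts (torso G T X t)" if "x \<in> side G T X t g" for x g
    using that by (auto simp: torso_def quotient_graph_def side_def intro: quotientI)
  moreover have "torso_rel G T X t `` {x} = torso_rel G T X t `` {y}"
    if "g \<in> incident_edges T t" "x \<in> side G T X t g" "y \<in> side G T X t g" for g x y
    using torso_class_side[OF that(1,2)] torso_class_side[OF that(1,3)] by simp
  moreover have "(\<lambda>v. torso_rel G T X t `` {v}) ` X t \<subseteq> (\<lambda>x. {x}) ` X t"
    using torso_class_bag[OF t] by auto
  ultimately show ?thesis
    using torso_contraction[OF t] unfolding tracks_def by (intro conjI ballI impI)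
qed

text \<open>A bold edge has a nonempty side. Representatives of these sides are sent by
  \<open>\<phi>\<close> to different vertices of \<open>H\<close>, so there are at most
  \<open>card (verts H)\<close> bold edges at \<open>t\<close>.\<close>

lemma tracks_adh_node:
  assumes G: "multigraph G" and dec: "tree_cut_decomposition G T X" and t: "t \<in> verts T"
    and k: "\<forall>f\<in>edges T. bold G T X f \<longrightarrow> card (adh_edge G T X f) \<le> k"
    and tr: "tracks P G T X t \<phi> H"
  shows "card (adh_node G T X t) \<le> card (verts H) * k"
proof -
  interpret tree_cut G T X using G dec by unfold_locales
  let ?B = "{g \<in> incident_edges T t. bold G T X g}"
  have fin: "finite ?B" using finite_tree(2) by (simp add: incident_edges_def)
  have "\<exists>x. x \<in> side G T X t g" if "g \<in> ?B" for g
  proof (rule ccontr)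
    assume "\<not> ?thesis"
    then have "adh_edge G T X g = {}" using that adh_edge_cut[of g t] by (simp add: cut_def)
    then show False using that by (simp add: bold_def)
  qed
  then obtain r where r: "\<And>g. g \<in> ?B \<Longrightarrow> r g \<in> side G T X t g" by metis
  have "inj_on (\<phi> \<circ> r) ?B"
  proof (rule inj_onI)
    fix g h assume g: "g \<in> ?B" and h: "h \<in> ?B" and "(\<phi> \<circ> r) g = (\<phi> \<circ> r) h"
    then show "g = h" using tracks_bold_unique[OF tr, of g h "r g" "r h"] r[OF g] r[OF h] by simp
  qed
  moreover have "(\<phi> \<circ> r) ` ?B \<subseteq> verts H" using tracks_verts[OF tr] r by auto
  moreover have "finite (verts H)" using tr unfolding tracks_def contraction_def by (elim conjE)
  ultimately have "card ?B \<le> card (verts H)" by (rule card_inj_on_le)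
  have "card (adh_node G T X t) \<le> (\<Sum>g\<in>?B. card (adh_edge G T X g))"
    unfolding adh_node_def using fin by (rule card_UN_le)
  also have "\<dots> \<le> card ?B * k"
    using k sum_bounded_above[of ?B "\<lambda>g. card (adh_edge G T X g)" k] by (auto simp: incident_edges_def)
  also have "\<dots> \<le> card (verts H) * k" using \<open>card ?B \<le> card (verts H)\<close> by simp
  finally show ?thesis .
qed

text \<open>The bag of \<open>t\<close> never changes, so the protected set is the same at every
  stage and the single steps can be chained.\<close>

lemma suppressions_refine:
  fixes T :: "(nat, nat) mgraph"
  assumes G: "multigraph G" and dec: "tree_cut_decomposition G T X" and t: "t \<in> verts T"
    and k: "\<forall>f\<in>edges T. bold G T X f \<longrightarrow> card (adh_edge G T X f) \<le> k"
    and sup: "(suppression ((\<lambda>x. {x}) ` X t))\<^sup>*\<^sup>* (torso G T X t) H"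
  shows "\<exists>T' X' \<phi>. refines_at k G T X t T' X' \<and> tracks ((\<lambda>x. {x}) ` X t) G T' X' t \<phi> H"
  using sup
proof (induction rule: rtranclp_induct)
  case base
  have "refines_at k G T X t T X" using dec k by (auto simp: refines_at_def)
  then show ?case using tracks_torso[OF G dec t] by blast
next
  case (step H H')
  then obtain T' X' \<phi> where r: "refines_at k G T X t T' X'"
    and tr: "tracks ((\<lambda>x. {x}) ` X t) G T' X' t \<phi> H" by blast
  then have "tree_cut_decomposition G T' X'" "t \<in> verts T'"
    "\<forall>f\<in>edges T'. bold G T' X' f \<longrightarrow> card (adh_edge G T' X' f) \<le> k"
    using t by (auto simp: refines_at_def)
  from tracks_suppression[OF G this tr step.hyps(2)] obtain T'' X'' \<phi>'
    where "refines_at k G T' X' t T'' X''" "tracks ((\<lambda>x. {x}) ` X t) G T'' X'' t \<phi>' H'" by blast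
  then show ?case using refines_at_trans[OF r _ t] by blast
qed

section \<open>Existence of the 3-center and treatment of all nodes\<close>

lemma suppression_verts:
  assumes "multigraph H" "suppression P H H'"
  obtains v where "v \<in> verts H" "v \<notin> P" "verts H' = verts H - {v}"
  using assms(2) that by cases (auto simp: delete_vertex_def add_edge_def)

text \<open>Every suppression removes a vertex. The resulting irreducible graph is the witness on
  which the choice in \<open>three_center\<close> rests.\<close>

lemma suppression_terminates:
  "multigraph H \<Longrightarrow> \<exists>H'. (suppression P)\<^sup>*\<^sup>* H H' \<and> (\<nexists>H''. suppression P H' H'')"
proof (induction "card (verts H)" arbitrary: H rule: less_induct)
  case less
  show ?case
  proof (cases "\<exists>H'. suppression P H H'")
    case True
    then obtain H' where H': "suppression P H H'" by blast
    obtain v where "v \<in> verts H" "verts H' = verts H - {v}"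
      using suppression_verts[OF less.prems H'] by blast
    then have "card (verts H') < card (verts H)"
      using less.prems card_Diff1_less[of "verts H" v] by (auto simp only: multigraph_def)
    from less.hyps[OF this suppression_multigraph[OF less.prems H']] H' show ?thesis
      by (meson converse_rtranclp_into_rtranclp)
  qed blast
qed

lemma three_center:
  assumes G: "multigraph G" and dec: "tree_cut_decomposition G T X" and t: "t \<in> verts T"
  shows "(suppression ((\<lambda>x. {x}) ` X t))\<^sup>*\<^sup>* (torso G T X t) (three_center G T X t)"
    and "\<nexists>H. suppression ((\<lambda>x. {x}) ` X t) (three_center G T X t) H"
proof -
  interpret tree_cut G T X using G dec by unfold_locales
  have "multigraph (torso G T X t)" using contraction_multigraph[OF G torso_contraction[OF t]] .
  from someI_ex[OF suppression_terminates[OF this, of "(\<lambda>x. {x}) ` X t"]]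
  show "(suppression ((\<lambda>x. {x}) ` X t))\<^sup>*\<^sup>* (torso G T X t) (three_center G T X t)"
    "\<nexists>H. suppression ((\<lambda>x. {x}) ` X t) (three_center G T X t) H"
    by (auto simp: three_center_def Let_def)
qed

text \<open>\<open>A\<close> consists of the nodes still to be treated. Nodes created on the way
  never enter it, their adhesion being bounded already; for a treated node, the bound on its
  3-center has been exchanged for the bound on its adhesion.\<close>

lemma refine_all:
  fixes T :: "(nat, nat) mgraph"
  assumes "finite A" and G: "multigraph G" and "tree_cut_decomposition G T X" and "A \<subseteq> verts T"
    and "\<forall>s\<in>verts T. card (X s) \<le> k"
    and "\<forall>f\<in>edges T. bold G T X f \<longrightarrow> card (adh_edge G T X f) \<le> k"
    and "\<forall>s\<in>A. card (verts (three_center G T X s)) \<le> k"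
    and "\<forall>s\<in>verts T - A. card (adh_node G T X s) \<le> k\<^sup>2"
  shows "\<exists>(T' :: (nat, nat) mgraph) X'. tree_cut_decomposition G T' X' \<and>
    (\<forall>s\<in>verts T'. card (adh_node G T' X' s) \<le> k\<^sup>2 \<and> card (X' s) \<le> k)"
  using assms(1,3-)
proof (induction A arbitrary: T X rule: finite_induct)
  case empty
  then show ?case by (intro exI[of _ T] exI[of _ X]) simp
next
  case (insert t A)
  have t: "t \<in> verts T" using insert.prems by auto
  note dec = insert.prems(1) and bold = insert.prems(4)
  obtain T' X' \<phi> where r: "refines_at k G T X t T' X'"
    and tr: "tracks ((\<lambda>x. {x}) ` X t) G T' X' t \<phi> (three_center G T X t)"
    using suppressions_refine[OF G dec t bold three_center(1)[OF G dec t]] by blast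
  have dec': "tree_cut_decomposition G T' X'"
    and bold': "\<forall>f\<in>edges T'. bold G T' X' f \<longrightarrow> card (adh_edge G T' X' f) \<le> k"
    and sub: "verts T \<subseteq> verts T'" and bags: "\<forall>s\<in>verts T. X' s = X s"
    and new: "\<forall>s\<in>verts T' - verts T. X' s = {} \<and> card (adh_node G T' X' s) \<le> k"
    and old: "\<forall>s\<in>verts T - {t}. adh_node G T' X' s = adh_node G T X s \<and>
        torso_rel G T' X' s = torso_rel G T X s"
    using r unfolding refines_at_def by blast+
  have "card (adh_node G T' X' t) \<le> card (verts (three_center G T X t)) * k"
    using tracks_adh_node[OF G dec' _ bold' tr] t sub by blast
  also have "\<dots> \<le> k\<^sup>2" using insert.prems(5) by (simp add: power2_eq_square)
  finally have adh_t: "card (adh_node G T' X' t) \<le> k\<^sup>2" .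
  show ?case
  proof (rule insert.IH[OF dec' _ _ bold'])
    show "A \<subseteq> verts T'" using insert.prems sub by auto
    show "\<forall>s\<in>verts T'. card (X' s) \<le> k" using insert.prems(3) bags new by (metis DiffI card.empty le0)
    show "\<forall>s\<in>A. card (verts (three_center G T' X' s)) \<le> k"
    proof
      fix s assume s: "s \<in> A"
      then have "s \<in> verts T - {t}" using insert by auto
      \<comment> \<open>\<open>three_center\<close> depends on the decomposition only through
        \<open>torso_rel\<close> and the bag, so the same graph is chosen for both
        decompositions.\<close>
      then have "three_center G T' X' s = three_center G T X s"
        using old bags by (simp add: three_center_def torso_def)
      then show "card (verts (three_center G T' X' s)) \<le> k" using insert.prems(5) s by simp
    qed
    have "k \<le> k\<^sup>2" by (cases k) (auto simp: power2_eq_square)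
    show "\<forall>s\<in>verts T' - A. card (adh_node G T' X' s) \<le> k\<^sup>2"
    proof
      fix s assume s: "s \<in> verts T' - A"
      consider "s = t" | "s \<in> verts T" "s \<noteq> t" | "s \<notin> verts T" by blast
      then show "card (adh_node G T' X' s) \<le> k\<^sup>2"
      proof cases
        case 2 then show ?thesis using old insert.prems(6) s by auto
      next
        case 3
        then have "card (adh_node G T' X' s) \<le> k" using new s by blast
        then show ?thesis using \<open>k \<le> k\<^sup>2\<close> by simp
      qed (use adh_t in simp)
    qed
  qed
qed

section \<open>Degrees under suppression and the size of the 3-center\<close>

text \<open>In a bypass the neighbour \<open>c\<close> keeps the edge \<open>e\<close>, and
  \<open>d\<close> loses \<open>e'\<close> but gains \<open>e\<close>. All other remaining vertices
  keep their edges.\<close>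

lemma suppression_degree:
  assumes H: "multigraph H" and s: "suppression P H H'" and x: "x \<in> verts H'"
  shows "degree H' x \<le> degree H x"
  using s
proof cases
  case (delete v)
  then have "incident_edges H' x \<subseteq> incident_edges H x"
    by (auto simp: delete_vertex_def incident_edges_def)
  then show ?thesis unfolding degree_def by (rule card_mono[OF finite_incident[OF H]])
next
  case (bypass v a b e)
  obtain c d e' where cd: "{c, d} = {a, b}" "ends H e = {v, c}" "ends H e' = {v, d}" "e' \<noteq> e"
    "incident_edges H v = {e, e'}"
    using bypass_incident[OF H bypass(4,5,6,7)] by blast
  have ee: "e \<in> edges H" "e' \<in> edges H" using cd(5) by (auto simp: incident_edges_def)
  have "x \<noteq> v" using x bypass by (auto simp: delete_vertex_def add_edge_def)
  have H': "edges H' = insert e (edges H - {e, e'})" "ends H' e = {c, d}" "\<And>g. g \<noteq> e \<Longrightarrow> ends H' g = ends H g"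
    using bypass cd by (auto simp: delete_vertex_def add_edge_def)
  show ?thesis
  proof (cases "x = d")
    case True
    then have e': "e' \<in> incident_edges H x" using cd ee by (auto simp: incident_edges_def)
    have "incident_edges H' x \<subseteq> insert e (incident_edges H x - {e'})"
      using H' by (auto simp: incident_edges_def)
    then have "card (incident_edges H' x) \<le> card (insert e (incident_edges H x - {e'}))"
      using finite_incident[OF H] by (intro card_mono) auto
    also have "\<dots> \<le> Suc (card (incident_edges H x - {e'}))"
      using finite_incident[OF H, of x] by (simp add: card_insert_if)
    also have "\<dots> = card (incident_edges H x)"
      using card_Suc_Diff1[OF finite_incident[OF H] e'] .
    finally show ?thesis unfolding degree_def .
  next
    case False
    have "incident_edges H' x \<subseteq> incident_edges H x"
      using H' False cd(2) ee by (auto simp: incident_edges_def split: if_splits)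
    then show ?thesis unfolding degree_def by (rule card_mono[OF finite_incident[OF H]])
  qed
qed

lemma suppressions_degree:
  assumes "(suppression P)\<^sup>*\<^sup>* H H'" "multigraph H"
  shows "multigraph H' \<and> verts H' \<subseteq> verts H \<and> (\<forall>x\<in>verts H'. degree H' x \<le> degree H x)"
  using assms(1)
proof (induction rule: rtranclp_induct)
  case (step H1 H2)
  then have H1: "multigraph H1" by blast
  obtain v where "verts H2 = verts H1 - {v}" using suppression_verts[OF H1 step.hyps(2)] by blast
  then show ?case
    using step.IH suppression_multigraph[OF H1 step.hyps(2)] suppression_degree[OF H1 step.hyps(2)]
    by (metis DiffD1 order_trans Diff_subset)
qed (use assms(2) in auto)

text \<open>Choosing an edge for each neighbour shows that there are at most
  \<open>degree H x\<close> neighbours. A degree of at most 2 would leave at most two of them, and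
  one of the two suppression rules would apply.\<close>

lemma irreducible_degree:
  assumes H: "multigraph H" and irr: "\<nexists>H'. suppression P H H'" and x: "x \<in> verts H" "x \<notin> P"
  shows "degree H x \<ge> 3"
proof (rule ccontr)
  assume "\<not> ?thesis"
  then have deg: "degree H x \<le> 2" by simp
  have "\<exists>g. \<forall>a\<in>neighbors H x. g a \<in> incident_edges H x \<and> ends H (g a) = {x, a}"
    by (meson neighborsE)
  then obtain g where g: "\<And>a. a \<in> neighbors H x \<Longrightarrow> g a \<in> incident_edges H x \<and> ends H (g a) = {x, a}"
    by blast
  have "inj_on g (neighbors H x)"
    by (rule inj_onI) (metis g doubleton_eq_iff)
  then have "card (neighbors H x) \<le> degree H x"
    unfolding degree_def using g finite_incident[OF H] by (intro card_inj_on_le[of g]) auto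
  then consider "card (neighbors H x) \<le> 1" | "card (neighbors H x) = 2" using deg by linarith
  then show False
  proof cases
    case 1
    then show ?thesis using irr suppression.delete[OF x deg] by blast
  next
    case 2
    then obtain a b where ab: "neighbors H x = {a, b}" "a \<noteq> b" by (auto simp: card_2_iff)
    then show ?thesis using irr suppression.bypass[OF x deg ab] g by blast
  qed
qed

lemma bold_edges_bound:
  assumes G: "multigraph G" and dec: "tree_cut_decomposition G T X" and t: "t \<in> verts T"
  shows "3 * card {f \<in> incident_edges T t. bold G T X f} \<le> 2 * card (adh_node G T X t)"
proof -
  interpret tree_cut G T X using G dec by unfold_locales
  let ?B = "{f \<in> incident_edges T t. bold G T X f}"
  have finB: "finite ?B" using finite_tree(2) by (simp add: incident_edges_def)
  have finA: "finite (adh_node G T X t)" using finite_adh_node[OF G] .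
  have "card ?B * 3 \<le> (\<Sum>f\<in>?B. card (adh_edge G T X f))"
    using sum_bounded_below[of ?B 3 "\<lambda>f. card (adh_edge G T X f)"] by (simp add: bold_def)
  also have "\<dots> = (\<Sum>f\<in>?B. \<Sum>e\<in>adh_node G T X t. if e \<in> adh_edge G T X f then 1 else 0)"
  proof (rule sum.cong)
    fix f assume "f \<in> ?B"
    then have "adh_edge G T X f = {e \<in> adh_node G T X t. e \<in> adh_edge G T X f}"
      by (auto simp: adh_node_def)
    then show "card (adh_edge G T X f) = (\<Sum>e\<in>adh_node G T X t. if e \<in> adh_edge G T X f then 1 else 0)"
      using finA by (simp add: sum.If_cases Int_def)
  qed simp
  also have "\<dots> = (\<Sum>e\<in>adh_node G T X t. \<Sum>f\<in>?B. if e \<in> adh_edge G T X f then 1 else 0)"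
    by (rule sum.swap)
  also have "\<dots> = (\<Sum>e\<in>adh_node G T X t. card {f \<in> ?B. e \<in> adh_edge G T X f})"
    using finB by (simp add: sum.If_cases Int_def)
  also have "\<dots> \<le> (\<Sum>e\<in>adh_node G T X t. 2)"
  proof (rule sum_mono)
    fix e assume "e \<in> adh_node G T X t"
    then have "e \<in> edges G" by (auto simp: adh_node_def adh_edge_def)
    then have ends: "card (ends G e) = 2" "finite (ends G e)"
      using G by (auto simp: multigraph_def card_ge_0_finite)
    let ?F = "{f \<in> ?B. e \<in> adh_edge G T X f}"
    \<comment> \<open>An edge in the cut of a side has an end on that side. Sides of different edges
      are disjoint, so \<open>r\<close> is injective into the two ends of \<open>e\<close>.\<close>
    have "\<exists>u. u \<in> ends G e \<and> u \<in> side G T X t f" if "f \<in> ?F" for f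
      using that adh_edge_cut by (auto simp: cut_def)
    then obtain r where r: "\<And>f. f \<in> ?F \<Longrightarrow> r f \<in> ends G e \<and> r f \<in> side G T X t f" by metis
    have "inj_on r ?F"
    proof (rule inj_onI)
      fix f g assume f: "f \<in> ?F" and g: "g \<in> ?F" and "r f = r g"
      then show "f = g" using r[OF f] r[OF g] side_disjoint[of f t g "r f"] by simp
    qed
    then have "card ?F \<le> card (ends G e)" using r ends(2) by (intro card_inj_on_le[of r]) blast+
    then show "card ?F \<le> 2" using ends by simp
  qed
  finally show ?thesis by simp
qed

lemma three_center_bound:
  assumes G: "multigraph G" and dec: "tree_cut_decomposition G T X" and t: "t \<in> verts T"
    and l: "card (adh_node G T X t) \<le> l" "card (X t) \<le> l"
  shows "card (verts (three_center G T X t)) \<le> 2 * l"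
proof -
  interpret tree_cut G T X using G dec by unfold_locales
  let ?P = "(\<lambda>x. {x}) ` X t" and ?H = "three_center G T X t"
  let ?B = "{f \<in> incident_edges T t. bold G T X f}"
  note con = torso_contraction[OF t]
  have mt: "multigraph (torso G T X t)" using contraction_multigraph[OF G con] .
  have H: "multigraph ?H" "verts ?H \<subseteq> verts (torso G T X t)"
    "\<forall>x\<in>verts ?H. degree ?H x \<le> degree (torso G T X t) x"
    using suppressions_degree[OF three_center(1)[OF G dec t] mt] by auto
  have "c \<in> ?P \<union> side G T X t ` ?B" if c: "c \<in> verts ?H" for c
  proof (cases "c \<in> ?P")
    case False
    then have deg: "degree (torso G T X t) c \<ge> 3"
      using irreducible_degree[OF H(1) three_center(2)[OF G dec t] c] H(3) c by fastforce
    obtain v where v: "v \<in> verts G" "c = torso_rel G T X t `` {v}"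
      using c H(2) by (auto simp: torso_def quotient_graph_def elim!: quotientE)
    have "v \<notin> X t" using False v torso_class_bag[OF t] by auto
    then obtain f where f: "f \<in> incident_edges T t" "v \<in> side G T X t f" using side_cover[OF t v(1)] by blast
    then have cf: "c = side G T X t f" using torso_class_side v by blast
    \<comment> \<open>A vertex of the torso is itself a set of vertices of \<open>G\<close>; if it
      is a side, it coincides with its own fibre under the class map. Its degree is therefore the
      size of the adhesion of \<open>f\<close>.\<close>
    have "{u \<in> verts G. torso_rel G T X t `` {u} = c} = side G T X t f"
    proof -
      have "u \<in> side G T X t f" if "u \<in> verts G" "torso_rel G T X t `` {u} = c" for u
        using that cf torso_rel_class_iff[OF t that(1) that(1)] torso_rel_iff[OF t, of u u] by blast
      moreover have "torso_rel G T X t `` {u} = c" if "u \<in> side G T X t f" for u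
        using that torso_class_side[OF f(1)] cf by simp
      ultimately show ?thesis using side_subset by blast
    qed
    then have "incident_edges (torso G T X t) c = adh_edge G T X f"
      using contraction_incident[OF G con, of c] adh_edge_cut[OF f(1)] by simp
    then have "bold G T X f" using deg by (simp add: degree_def bold_def)
    then show ?thesis using f cf by blast
  qed simp
  then have "verts ?H \<subseteq> ?P \<union> side G T X t ` ?B" by blast
  moreover have fin: "finite ?P" "finite ?B"
    using finite_bag[OF t] finite_tree(2) by (auto simp: incident_edges_def)
  ultimately have "card (verts ?H) \<le> card (?P \<union> side G T X t ` ?B)" by (intro card_mono) auto
  also have "\<dots> \<le> card ?P + card (side G T X t ` ?B)" by (rule card_Un_le)
  also have "\<dots> \<le> card (X t) + card ?B"
    using fin finite_bag[OF t] by (intro add_mono card_image_le) auto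
  \<comment> \<open>There are at most \<open>2 * l / 3\<close> bold edges, hence at most
    \<open>l\<close> in addition to the bag.\<close>
  also have "\<dots> \<le> 2 * l" using bold_edges_bound[OF G dec t] l by simp
  finally show ?thesis .
qed

section \<open>The two inequalities\<close>

text \<open>It yields a decomposition of every graph, so that the minima behind both
  \<open>LEAST\<close> operators are attained.\<close>

definition single_node_tree :: "(nat, nat) mgraph" where
  "single_node_tree = \<lparr>verts = {0}, edges = {}, ends = (\<lambda>_. {})\<rparr>"

lemma single_node_decomposition: "tree_cut_decomposition G single_node_tree (\<lambda>_. verts G)"
proof -
  have "is_tree single_node_tree"
    by (rule is_treeI) (auto simp: single_node_tree_def multigraph_def)
  then show ?thesis
    by (simp add: tree_cut_decomposition_def single_node_tree_def disjoint_family_on_def)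
qed

lemma bag_survives:
  assumes "(suppression P)\<^sup>*\<^sup>* H H'" "multigraph H"
  shows "P \<inter> verts H \<subseteq> verts H'"
  using assms(1)
proof (induction rule: rtranclp_induct)
  case (step H1 H2)
  have "multigraph H1" using suppressions_degree[OF step.hyps(1) assms(2)] by blast
  then obtain v where "v \<notin> P" "verts H2 = verts H1 - {v}"
    using suppression_verts[OF _ step.hyps(2)] by blast
  then show ?case using step.IH by blast
qed simp

text \<open>Suppression spares the vertices of the bag, so Wollan's width bounds the bags as well,
  although it does not mention them.\<close>

lemma bag_le_three_center:
  assumes G: "multigraph G" and dec: "tree_cut_decomposition G T X" and t: "t \<in> verts T"
  shows "card (X t) \<le> card (verts (three_center G T X t))"
proof -
  interpret tree_cut G T X using G dec by unfold_locales
  let ?P = "(\<lambda>x. {x}) ` X t"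
  have mt: "multigraph (torso G T X t)" using contraction_multigraph[OF G torso_contraction[OF t]] .
  have "{v} \<in> verts (torso G T X t)" if "v \<in> X t" for v
  proof -
    have "v \<in> verts G" using that bag_subset[OF t] by blast
    then have "torso_rel G T X t `` {v} \<in> verts G // torso_rel G T X t" by (rule quotientI)
    then show ?thesis using torso_class_bag[OF t that] by (simp add: torso_def quotient_graph_def)
  qed
  then have "?P \<subseteq> verts (three_center G T X t)"
    using bag_survives[OF three_center(1)[OF G dec t] mt] by blast
  moreover have "finite (verts (three_center G T X t))"
    using suppressions_degree[OF three_center(1)[OF G dec t] mt] by (simp add: multigraph_def)
  ultimately have "card ?P \<le> card (verts (three_center G T X t))" by (simp add: card_mono)
  then show ?thesis by (simp add: card_image)
qed

theorem corollary3p5: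
  fixes G :: "('v, 'e) mgraph" and k l :: nat
  assumes "multigraph G"
    and "k = wollan_tree_cut_width G"
    and "l = ab_tree_cut_width G"
  shows "real k / 2 - 1 \<le> real l \<and> l \<le> k ^ 2"
proof -
  note G = assms(1)
  let ?ab = "\<lambda>l. \<exists>(T :: (nat, nat) mgraph) X.
     tree_cut_decomposition G T X \<and> adhesion_width G T X \<le> l \<and> bag_width T X \<le> l"
  let ?wo = "\<lambda>k. \<exists>(T :: (nat, nat) mgraph) X. tree_cut_decomposition G T X \<and> wollan_width G T X = k"
  have "?ab (max (adhesion_width G single_node_tree (\<lambda>_. verts G)) (bag_width single_node_tree (\<lambda>_. verts G)))"
    using single_node_decomposition by (metis max.cobounded1 max.cobounded2)
  then have "?ab l" unfolding assms(3) ab_tree_cut_width_def by (rule LeastI)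
  then obtain T :: "(nat, nat) mgraph" and X where T: "tree_cut_decomposition G T X"
    "adhesion_width G T X \<le> l" "bag_width T X \<le> l" by blast
  interpret T: tree_cut G T X using G T(1) by unfold_locales
  have adh: "card (adh_node G T X t) \<le> l" and bag: "card (X t) \<le> l" if "t \<in> verts T" for t
    using T(2,3) T.finite_tree that unfolding adhesion_width_def bag_width_def
    by (simp_all add: Max_le_iff)
  \<comment> \<open>The adhesion of a bold edge is part of the adhesion of either of its ends, and a
    thin edge has an adhesion of at most 2. The bound \<open>2 * l + 2\<close> covers both
    cases.\<close>
  have edge: "card (adh_edge G T X f) \<le> 2 * l + 2" if f: "f \<in> edges T" for f
  proof (cases "bold G T X f")
    case True
    obtain s where s: "s \<in> verts T" "f \<in> incident_edges T s"
      using multigraph_endsE[OF is_tree_multigraph[OF T.tree] f] f by (auto simp: incident_edges_def)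
    have "adh_edge G T X f \<subseteq> adh_node G T X s" using True s by (auto simp: adh_node_def)
    then have "card (adh_edge G T X f) \<le> card (adh_node G T X s)"
      by (rule card_mono[OF finite_adh_node[OF G]])
    then show ?thesis using adh[OF s(1)] by simp
  qed (simp add: bold_def)
  have "card (verts (three_center G T X t)) \<le> 2 * l + 2" if "t \<in> verts T" for t
    using three_center_bound[OF G T(1) that adh[OF that] bag[OF that]] by simp
  then have "wollan_width G T X \<le> 2 * l + 2"
    unfolding wollan_width_def using T.finite_tree edge by (subst Max_le_iff) auto
  moreover have "k \<le> wollan_width G T X"
    unfolding assms(2) wollan_tree_cut_width_def using T(1) by (intro Least_le) blast
  ultimately have "k \<le> 2 * l + 2" by simp
  moreover have "l \<le> k\<^sup>2"
  proof -
    have "?wo (wollan_width G single_node_tree (\<lambda>_. verts G))" using single_node_decomposition by blast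
    then have "?wo k" unfolding assms(2) wollan_tree_cut_width_def by (rule LeastI)
    then obtain T :: "(nat, nat) mgraph" and X where T: "tree_cut_decomposition G T X"
      "wollan_width G T X = k" by blast
    interpret T: tree_cut G T X using G T(1) by unfold_locales
    have edge: "card (adh_edge G T X f) \<le> k" if "f \<in> edges T" for f
      using T(2) T.finite_tree that unfolding wollan_width_def by (auto intro!: Max_ge)
    have node: "card (verts (three_center G T X t)) \<le> k" if "t \<in> verts T" for t
      using T(2) T.finite_tree that unfolding wollan_width_def by (auto intro!: Max_ge)
    have "card (X t) \<le> k" if "t \<in> verts T" for t
      using bag_le_three_center[OF G T(1) that] node[OF that] by simp
    then obtain T' :: "(nat, nat) mgraph" and X' where T': "tree_cut_decomposition G T' X'"
      "\<forall>s\<in>verts T'. card (adh_node G T' X' s) \<le> k\<^sup>2 \<and> card (X' s) \<le> k"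
      using refine_all[OF T.finite_tree(1) G T(1), of k] edge node by auto
    interpret T': tree_cut G T' X' using G T'(1) by unfold_locales
    have "k \<le> k\<^sup>2" by (cases k) (auto simp: power2_eq_square)
    then have "adhesion_width G T' X' \<le> k\<^sup>2" "bag_width T' X' \<le> k\<^sup>2"
      using T' T'.finite_tree unfolding adhesion_width_def bag_width_def
      by (auto simp: Max_le_iff intro: order_trans)
    then show ?thesis unfolding assms(3) ab_tree_cut_width_def using T'(1) by (intro Least_le) blast
  qed
  ultimately show ?thesis by (simp add: field_simps)
qed

end
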